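(* There exist absolute constants $\lambda_*>1$, $B>0$, $B_0>0$ such that the following holds. Let $n\ge 1$, $c\in\mathbb{C}$, and let $O(c)$ be a repelling periodic orbit of $f_c(z)=z^2+c$ of exact period $n$ whose multiplier $\rho=\rho(c)$ satisfies $|\rho|<e$. Then $$\Big|n\rho-n+2c\frac{\rho'(c)}{\rho(c)}\Big|\le K_n(c)\Big\{\log|\rho(c)|+\frac{|\rho'(c)|}{|\rho(c)|}\,\frac1\pi\,\mathrm{area}\big(\{z:0<G_c(z)<2^{-n}\log\lambda_*\}\big)\Big\},$$ where $$K_n(c)=\frac{2}{\log\lambda_*}\max\{|(f_c^n)'(z)|:\ G_c(f_c^n(z))=2\log\lambda_*\},$$ and moreover $$K_n(c)\le B(2\beta)^n,$$ where $\beta$ is the unique positive solution of the equation $\beta^2-|c|=\beta$, and also $$K_n(c)\le B_0 4^n.$$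
   Context: $G_c(z)=\lim_{k\to\infty}2^{-k}\log^+|f_c^k(z)|$ is Green's function of the basin of infinity of $f_c$, extended by $0$ to the whole plane. The multiplier of a periodic orbit $O=\{b_k\}_{k=1}^n$ of exact period $n$ is $\rho=(f_c^n)'(b_k)$. If $\rho\ne1$, the orbit extends by the implicit function theorem to a periodic orbit $O(c)=\{b_k(c)\}$ depending holomorphically on the parameter $c$ locally, and its multiplier $\rho(c)=2^n b_1(c)\cdots b_n(c)$ is holomorphic in $c$; $\rho'(c)$ denotes its derivative with respect to $c$. *)

theory Defs
  imports "HOL-Complex_Analysis.Complex_Analysis"
begin

definition quad :: "complex \<Rightarrow> complex \<Rightarrow> complex" where
  "quad c z = z\<^sup>2 + c"

text \<open>
  The maximum with 1 inside the logarithm renders \<open>log\<^sup>+\<close>. The limit is 0 at points with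
  bounded orbit, so this is already the extension by 0 to the whole plane.
\<close>

definition green :: "complex \<Rightarrow> complex \<Rightarrow> real" where
  "green c z = lim (\<lambda>k. ln (max 1 (cmod ((quad c ^^ k) z))) / 2 ^ k)"

definition exact_period :: "nat \<Rightarrow> complex \<Rightarrow> complex \<Rightarrow> bool" where
  "exact_period n c z \<longleftrightarrow>
     n \<ge> 1 \<and> (quad c ^^ n) z = z \<and> (\<forall>k. 1 \<le> k \<and> k < n \<longrightarrow> (quad c ^^ k) z \<noteq> z)"

text \<open>
  A periodic orbit is represented by any one of its points \<open>z\<close>; by the chain rule the multiplier
  does not depend on which one.
\<close>

definition multiplier :: "nat \<Rightarrow> complex \<Rightarrow> complex \<Rightarrow> complex" where
  "multiplier n c z = deriv (quad c ^^ n) z"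

definition repelling_orbit :: "nat \<Rightarrow> complex \<Rightarrow> complex \<Rightarrow> bool" where
  "repelling_orbit n c z \<longleftrightarrow> exact_period n c z \<and> cmod (multiplier n c z) > 1"

text \<open>
  \<open>b\<close> is a holomorphic continuation, near the parameter \<open>c\<close>, of the periodic point \<open>z\<close>; the
  remaining points of the continued orbit are the iterates of \<open>b w\<close> under \<open>quad w\<close>.
\<close>

definition periodic_continuation ::
    "nat \<Rightarrow> complex \<Rightarrow> complex \<Rightarrow> (complex \<Rightarrow> complex) \<Rightarrow> bool" where
  "periodic_continuation n c z b \<longleftrightarrow>
     b c = z \<and>
     (\<exists>U. open U \<and> c \<in> U \<and> b holomorphic_on U \<and> (\<forall>w\<in>U. (quad w ^^ n) (b w) = b w))"

text \<open>
  If the multiplier at \<open>c\<close> is not 1, a continuation exists and its germ at \<open>c\<close> is unique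
  (implicit function theorem), so the derivative below does not depend on the choice made.
\<close>

definition continued_point :: "nat \<Rightarrow> complex \<Rightarrow> complex \<Rightarrow> complex \<Rightarrow> complex" where
  "continued_point n c z = (SOME b. periodic_continuation n c z b)"

definition multiplier_deriv :: "nat \<Rightarrow> complex \<Rightarrow> complex \<Rightarrow> complex" where
  "multiplier_deriv n c z = deriv (\<lambda>w. multiplier n w (continued_point n c z w)) c"

definition area :: "complex set \<Rightarrow> real" where
  "area S = measure lebesgue S"

text \<open>
  For \<open>L > 1\<close> the level set is compact and nonempty, so the supremum is a maximum.
\<close>

definition K_const :: "real \<Rightarrow> nat \<Rightarrow> complex \<Rightarrow> real" where
  "K_const L n c =
     2 / ln L * Sup {cmod (deriv (quad c ^^ n) z) |z. green c ((quad c ^^ n) z) = 2 * ln L}"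

definition beta :: "complex \<Rightarrow> real" where
  "beta c = (THE b. b > 0 \<and> b\<^sup>2 - cmod c = b)"

end

theory Submission
  imports Defs
begin

text \<open>
  Let \<open>b\<^sub>0, \<dots>, b\<^bsub>n-1\<^esub>\<close> be the cycle. The quadratic differential
  \<open>A(x) = \<Sum>\<^sub>k 1/(x - b\<^sub>k)\<^sup>2 + r\<^sub>k/(x - b\<^sub>k)\<close>, with residues chosen so that the double poles are carried
  along the cycle, satisfies \<open>A - f\<^sub>*A = S/(x - c)\<close> with \<open>S = \<Sum>\<^sub>k r\<^sub>k = \<rho>'/\<rho>\<close>. Pushing \<open>A\<close> forward under
  \<open>f\<^sup>n\<close> with weight \<open>1/(f\<^sup>n)'\<close> instead of \<open>1/((f\<^sup>n)')\<^sup>2\<close> gives \<open>\<Sum>\<^sub>k \<rho>/(x - b\<^sub>k)\<^sup>2 + r\<^sub>k/(x - b\<^sub>k)\<close>; its first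
  moment over a large circle is \<open>\<Sum>\<^sub>k \<rho> + r\<^sub>k b\<^sub>k = n \<rho> - n + 2 c \<rho>'/\<rho>\<close>. Averaging over the radii of an
  annulus near \<open>log \<lambda>\<^sub>* < G < 2 log \<lambda>\<^sub>*\<close> bounds this by \<open>max \<bar>(f\<^sup>n)'\<bar>\<close> times the \<open>L\<^sup>1\<close> norm of \<open>A\<close> on
  \<open>{t \<le> G < 2 t}\<close>, \<open>t = 2\<^sup>-\<^sup>n log \<lambda>\<^sub>*\<close>. As pushing forward does not increase \<open>L\<^sup>1\<close> norms, comparing the norms
  over \<open>{0 < G < 2 t}\<close> and its preimage \<open>{0 < G < t}\<close>, both without small discs around the cycle,
  bounds that norm by the integral over a ring of modulus \<open>log \<bar>\<rho>\<bar>\<close> at a point of the cycle, plus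
  \<open>\<bar>S\<bar>\<close> times the integral of \<open>1/\<bar>x - c\<bar>\<close> over \<open>{0 < G < 2 t}\<close>, which is twice the area of \<open>{0 < G < t}\<close>.

  The hypothesis \<open>\<bar>\<rho>\<bar> < e\<close> enters only through the parameter: for \<open>\<bar>c\<bar> > 2\<close> every step along the cycle
  expands a suitable metric by \<open>sqrt (\<bar>c\<bar>/2)\<close>, so \<open>\<bar>c\<bar> \<le> 2 exp (2/n)\<close>.
\<close>

unbundle no fps_syntax

section \<open>Change of variables in the complex plane\<close>

text \<open>The change-of-variables theorem \<open>has_measure_differentiable_image\<close> takes
  the Jacobian as the determinant of a matrix. It is therefore applied on \<open>real^2\<close> and
  carried over to \<open>complex\<close> by this isometry.\<close>

definition cplx_of_vec :: "real^2 \<Rightarrow> complex" where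
  "cplx_of_vec v = Complex (v$1) (v$2)"

definition vec_of_cplx :: "complex \<Rightarrow> real^2" where
  "vec_of_cplx z = vector [Re z, Im z]"

lemma cplx_of_vec_inverse [simp]: "cplx_of_vec (vec_of_cplx z) = z"
  by (simp add: cplx_of_vec_def vec_of_cplx_def)

lemma vec_of_cplx_inverse [simp]: "vec_of_cplx (cplx_of_vec v) = v"
  by (simp add: cplx_of_vec_def vec_of_cplx_def vec_eq_iff forall_2)

lemma vec_of_cplx_nth [simp]: "vec_of_cplx z $ 1 = Re z" "vec_of_cplx z $ 2 = Im z"
  by (simp_all add: vec_of_cplx_def)

lemma Re_Im_cplx_of_vec [simp]: "Re (cplx_of_vec v) = v $ 1" "Im (cplx_of_vec v) = v $ 2"
  by (simp_all add: cplx_of_vec_def)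

lemma linear_cplx_of_vec: "linear cplx_of_vec"
  by (rule linearI) (simp_all add: complex_eq_iff)

lemma linear_vec_of_cplx: "linear vec_of_cplx"
  by (rule linearI) (simp_all add: vec_eq_iff forall_2)

lemma borel_measurable_cplx_of_vec [measurable]: "cplx_of_vec \<in> borel_measurable borel"
  using linear_cplx_of_vec
  by (simp add: borel_measurable_continuous_onI linear_continuous_on linear_conv_bounded_linear)

text \<open>Lebesgue measure is determined by its values on boxes, and the preimage of a box is a
  box with the same sides.\<close>

lemma lborel_distr_cplx_of_vec: "distr lborel borel cplx_of_vec = lborel"
proof (rule lborel_eqI[symmetric])
  fix l u :: complex
  assume lu: "\<And>b. b \<in> Basis \<Longrightarrow> l \<bullet> b \<le> u \<bullet> b"
  have le: "Re l \<le> Re u" "Im l \<le> Im u"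
    using lu[of 1] lu[of \<i>] by (auto simp: Basis_complex_def)
  have pre: "cplx_of_vec -` box l u = box (vec_of_cplx l) (vec_of_cplx u)"
    by (auto simp: in_box_complex_iff mem_box_cart forall_2)
  have "emeasure (distr lborel borel cplx_of_vec) (box l u) 
      = emeasure lborel (box (vec_of_cplx l) (vec_of_cplx u))"
    by (subst emeasure_distr) (auto simp: pre)
  also have "\<dots> = (\<Prod>b\<in>Basis. (vec_of_cplx u - vec_of_cplx l) \<bullet> b)"
    using le by (subst emeasure_lborel_box)
      (auto simp: Basis_vec_def inner_axis forall_2 exhaust_2 UNIV_2)
  also have "(\<Prod>b\<in>Basis. (vec_of_cplx u - vec_of_cplx l) \<bullet> b) = (\<Prod>b\<in>Basis. (u - l) \<bullet> b)"
  proof -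
    have B: "(Basis :: (real^2) set) = {axis 1 1, axis 2 1}"
      by (auto simp: Basis_vec_def UNIV_2)
    have "axis 1 1 \<noteq> (axis 2 1 :: real^2)" by (simp add: axis_eq_axis)
    then show ?thesis by (simp add: B Basis_complex_def inner_axis)
  qed
  finally show "emeasure (distr lborel borel cplx_of_vec) (box l u) = (\<Prod>b\<in>Basis. (u - l) \<bullet> b)" .
qed simp

lemma emeasure_lborel_vec_image:
  assumes "B \<in> sets borel"
  shows "vec_of_cplx ` B \<in> sets borel" "emeasure lborel (vec_of_cplx ` B) = emeasure lborel B"
proof -
  have eq: "vec_of_cplx ` B = cplx_of_vec -` B"
  proof safe
    fix v assume "cplx_of_vec v \<in> B"
    then have "vec_of_cplx (cplx_of_vec v) \<in> vec_of_cplx ` B" by blast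
    then show "v \<in> vec_of_cplx ` B" by simp
  qed simp
  show "vec_of_cplx ` B \<in> sets borel"
    using measurable_sets[OF borel_measurable_cplx_of_vec assms] eq by simp
  have "emeasure lborel B = emeasure (distr lborel borel cplx_of_vec) B"
    by (simp add: lborel_distr_cplx_of_vec)
  also have "\<dots> = emeasure lborel (vec_of_cplx ` B)"
    using assms by (subst emeasure_distr) (auto simp: eq)
  finally show "emeasure lborel (vec_of_cplx ` B) = emeasure lborel B" by simp
qed

lemma nn_integral_cplx_of_vec:
  assumes [measurable]: "h \<in> borel_measurable borel"
  shows "(\<integral>\<^sup>+v. h (cplx_of_vec v) \<partial>lborel) = (\<integral>\<^sup>+z. h z \<partial>lborel)"
proof -
  have "(\<integral>\<^sup>+z. h z \<partial>lborel) = (\<integral>\<^sup>+z. h z \<partial>(distr lborel borel cplx_of_vec))"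
    by (simp add: lborel_distr_cplx_of_vec)
  also have "\<dots> = (\<integral>\<^sup>+v. h (cplx_of_vec v) \<partial>lborel)"
    by (subst nn_integral_distr) auto
  finally show ?thesis by simp
qed

text \<open>Tonelli's theorem, after a comparison on boxes has identified \<open>lborel\<close> on
  \<open>complex\<close> with a product measure.\<close>

lemma nn_integral_complex_iterated:
  assumes [measurable]: "h \<in> borel_measurable borel"
  shows "(\<integral>\<^sup>+z. h z \<partial>lborel) = (\<integral>\<^sup>+x. \<integral>\<^sup>+y. h (Complex x y) \<partial>lborel \<partial>lborel)"
proof -
  let ?F = "\<lambda>p::real\<times>real. Complex (fst p) (snd p)"
  have "continuous_on UNIV ?F"
    unfolding complex_eq_iff Complex_eq by (intro continuous_intros)
  then have [measurable]: "?F \<in> borel_measurable borel"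
    by (rule borel_measurable_continuous_onI)
  have "distr lborel borel ?F = lborel"
  proof (rule lborel_eqI[symmetric])
    fix l u :: complex
    assume lu: "\<And>b. b \<in> Basis \<Longrightarrow> l \<bullet> b \<le> u \<bullet> b"
    have le: "Re l \<le> Re u" "Im l \<le> Im u"
      using lu[of 1] lu[of \<i>] by (auto simp: Basis_complex_def)
    have pre: "?F -` box l u = {Re l<..<Re u} \<times> {Im l<..<Im u}"
      by (auto simp: in_box_complex_iff)
    have "emeasure (distr lborel borel ?F) (box l u) 
      = emeasure (lborel \<Otimes>\<^sub>M lborel) ({Re l<..<Re u} \<times> {Im l<..<Im u})"
      by (subst emeasure_distr) (auto simp: pre lborel_prod)
    also have "\<dots> = (Re u - Re l) * (Im u - Im l)"
      using le by (subst lborel.emeasure_pair_measure_Times) (auto simp: ennreal_mult')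
    also have "\<dots> = (\<Prod>b\<in>Basis. (u - l) \<bullet> b)"
      by (simp add: Basis_complex_def)
    finally show "emeasure (distr lborel borel ?F) (box l u) = (\<Prod>b\<in>Basis. (u - l) \<bullet> b)" .
  qed simp
  then have "(\<integral>\<^sup>+z. h z \<partial>lborel) = (\<integral>\<^sup>+z. h z \<partial>(distr lborel borel ?F))" by simp
  also have "\<dots> = (\<integral>\<^sup>+p. h (?F p) \<partial>(lborel \<Otimes>\<^sub>M lborel))"
    by (subst nn_integral_distr) (auto simp: lborel_prod)
  also have "\<dots> = (\<integral>\<^sup>+x. \<integral>\<^sup>+y. h (Complex x y) \<partial>lborel \<partial>lborel)"
    by (subst lborel.nn_integral_fst[symmetric]) (auto simp: lborel_prod)
  finally show ?thesis .
qed

text \<open>By the Cauchy-Riemann equations the real Jacobian of a holomorphic map is the squared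
  modulus of its derivative.\<close>

lemma emeasure_holomorphic_image:
  assumes "open S" "f holomorphic_on S" "inj_on f S" "B \<in> sets borel" "B \<subseteq> S" "f ` B \<in> sets borel"
  shows "emeasure lborel (f ` B) = (\<integral>\<^sup>+w. indicator B w * ennreal ((cmod (deriv f w))\<^sup>2) \<partial>lborel)"
proof -
  define F where "F = (\<lambda>v. vec_of_cplx (f (cplx_of_vec v)))"
  define F' where "F' = (\<lambda>v u. vec_of_cplx (deriv f (cplx_of_vec v) * cplx_of_vec u))"
  let ?B = "vec_of_cplx ` B"
  have blc: "bounded_linear cplx_of_vec" and blv: "bounded_linear vec_of_cplx"
    using linear_cplx_of_vec linear_vec_of_cplx by (auto simp: linear_conv_bounded_linear)
  have der: "(F has_derivative F' v) (at v within ?B)" if "v \<in> ?B" for v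
  proof -
    have "cplx_of_vec v \<in> S" using that assms by auto
    then have "(f has_field_derivative deriv f (cplx_of_vec v)) (at (cplx_of_vec v))"
      using assms by (meson holomorphic_derivI)
    then have 1: "(f has_derivative (\<lambda>h. deriv f (cplx_of_vec v) * h)) (at (cplx_of_vec v))"
      by (simp add: has_field_derivative_def)
    have "((\<lambda>v. f (cplx_of_vec v)) has_derivative (\<lambda>u. deriv f (cplx_of_vec v) * cplx_of_vec u)) (at v within ?B)"
      by (rule has_derivative_compose[OF bounded_linear_imp_has_derivative[OF blc] 1])
    from has_derivative_compose[OF this bounded_linear_imp_has_derivative[OF blv]]
    show ?thesis unfolding F_def F'_def .
  qed
  have inj: "inj_on F ?B"
  proof (rule inj_onI)
    fix u v assume uv: "u \<in> ?B" "v \<in> ?B" "F u = F v"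
    then have "f (cplx_of_vec u) = f (cplx_of_vec v)"
      by (metis F_def cplx_of_vec_inverse)
    moreover have "cplx_of_vec u \<in> S" "cplx_of_vec v \<in> S" using uv assms by auto
    ultimately have "cplx_of_vec u = cplx_of_vec v" using assms by (meson inj_onD)
    then show "u = v" by (metis vec_of_cplx_inverse)
  qed
  have detF: "det (matrix (F' v)) = (cmod (deriv f (cplx_of_vec v)))\<^sup>2" for v
    unfolding F'_def
    unfolding cmod_power2 by (simp add: det_2 matrix_def axis_def power2_eq_square)
  have mB: "?B \<in> sets borel" and FB: "F ` ?B = vec_of_cplx ` (f ` B)"
    using emeasure_lborel_vec_image[OF assms(4)] by (auto simp: F_def image_image)
  have mFB: "F ` ?B \<in> sets borel" "emeasure lborel (F ` ?B) = emeasure lborel (f ` B)"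
    unfolding FB using emeasure_lborel_vec_image[OF assms(6)] by auto
  have iff: "F ` ?B \<in> lmeasurable \<and> measure lebesgue (F ` ?B) = m
     \<longleftrightarrow> ((\<lambda>v. (cmod (deriv f (cplx_of_vec v)))\<^sup>2) has_integral m) ?B" for m
    using has_measure_differentiable_image[OF _ der inj, of m] mB
    by (simp add: detF) 
  have [measurable]: "(\<lambda>w. indicator B w * ennreal ((cmod (deriv f w))\<^sup>2)) \<in> borel_measurable borel"
  proof -
    have "deriv f holomorphic_on S" using assms by (simp add: holomorphic_deriv)
    then have "continuous_on S (\<lambda>w. ennreal ((cmod (deriv f w))\<^sup>2))"
      by (intro continuous_on_ennreal continuous_on_power continuous_on_norm holomorphic_on_imp_continuous_on)
    then have "(\<lambda>w. ennreal ((cmod (deriv f w))\<^sup>2)) \<in> borel_measurable (restrict_space borel S)"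
      by (rule borel_measurable_continuous_on_restrict)
    then have "(\<lambda>w. indicator S w * ennreal ((cmod (deriv f w))\<^sup>2)) \<in> borel_measurable borel"
      using assms(1) by (subst (asm) borel_measurable_restrict_space_iff_ennreal) (auto simp: mult.commute)
    then have "(\<lambda>w. indicator B w * (indicator S w * ennreal ((cmod (deriv f w))\<^sup>2))) \<in> borel_measurable borel"
      using assms(4) by measurable
    also have "(\<lambda>w. indicator B w * (indicator S w * ennreal ((cmod (deriv f w))\<^sup>2))) 
       = (\<lambda>w. indicator B w * ennreal ((cmod (deriv f w))\<^sup>2))"
      using assms(5) by (auto simp: fun_eq_iff indicator_def)
    finally show ?thesis .
  qed
  have "(\<integral>\<^sup>+w. indicator B w * ennreal ((cmod (deriv f w))\<^sup>2) \<partial>lborel)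
      = (\<integral>\<^sup>+v. indicator ?B v * ennreal ((cmod (deriv f (cplx_of_vec v)))\<^sup>2) \<partial>lborel)"
  proof (subst nn_integral_cplx_of_vec[symmetric])
    have "indicator B (cplx_of_vec v) = (indicator ?B v :: ennreal)" for v
      by (auto simp: indicator_def) (metis imageI vec_of_cplx_inverse)
    then show "(\<integral>\<^sup>+ v. indicator B (cplx_of_vec v) * ennreal ((cmod (deriv f (cplx_of_vec v)))\<^sup>2) \<partial>lborel) =
    (\<integral>\<^sup>+ v. indicator ?B v * ennreal ((cmod (deriv f (cplx_of_vec v)))\<^sup>2) \<partial>lborel)"
      by simp
  qed simp
  \<comment> \<open>\<open>iff\<close> speaks of finite values only. If the image has infinite
    measure, the integral is infinite as well: a finite one would give a \<open>has_integral\<close>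
    statement and make the image \<open>lmeasurable\<close>.\<close>
  also have "\<dots> = emeasure lborel (F ` ?B)"
  proof (cases "emeasure lborel (F ` ?B) < \<infinity>")
    case True
    then have lm: "F ` ?B \<in> lmeasurable"
      using mFB by (intro fmeasurableI) auto
    then have "((\<lambda>v. (cmod (deriv f (cplx_of_vec v)))\<^sup>2) has_integral measure lebesgue (F ` ?B)) ?B"
      using iff by blast
    from nn_integral_has_integral_lebesgue[OF _ this]
    have "(\<integral>\<^sup>+v. ennreal (indicator ?B v * ((cmod (deriv f (cplx_of_vec v)))\<^sup>2)) \<partial>lborel)
      = ennreal (measure lebesgue (F ` ?B))" by auto
    also have "\<dots> = emeasure lborel (F ` ?B)"
      using True mFB by (simp add: measure_def)
    finally show ?thesis by (simp add: ennreal_mult' ennreal_indicator)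
  next
    case False
    have "\<not> (\<integral>\<^sup>+v. indicator ?B v * ennreal ((cmod (deriv f (cplx_of_vec v)))\<^sup>2) \<partial>lborel) < \<infinity>"
    proof
      let ?g = "\<lambda>v. indicator ?B v * ((cmod (deriv f (cplx_of_vec v)))\<^sup>2)"
      assume "(\<integral>\<^sup>+v. indicator ?B v * ennreal ((cmod (deriv f (cplx_of_vec v)))\<^sup>2) \<partial>lborel) < \<infinity>"
      then have fin: "(\<integral>\<^sup>+v. ennreal (?g v) \<partial>lborel) < \<infinity>"
        by (simp add: ennreal_mult' ennreal_indicator)
      have "(\<lambda>w. enn2real (indicator B w * ennreal ((cmod (deriv f w))\<^sup>2))) \<in> borel_measurable borel"
        by measurable
      then have "(\<lambda>v. enn2real (indicator B (cplx_of_vec v) * ennreal ((cmod (deriv f (cplx_of_vec v)))\<^sup>2))) \<in> borel_measurable borel"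
        by measurable
      also have "(\<lambda>v. enn2real (indicator B (cplx_of_vec v) * ennreal ((cmod (deriv f (cplx_of_vec v)))\<^sup>2))) = ?g"
        by (auto simp: indicator_def fun_eq_iff) (metis imageI vec_of_cplx_inverse)
      finally have "?g \<in> borel_measurable borel" .
      then have "(?g has_integral (enn2real (\<integral>\<^sup>+v. ennreal (?g v) \<partial>lborel))) UNIV"
        using fin by (intro nn_integral_has_integral) (auto simp: less_top)
      then have "((\<lambda>v. (cmod (deriv f (cplx_of_vec v)))\<^sup>2) has_integral 
           (enn2real (\<integral>\<^sup>+v. ennreal (?g v) \<partial>lborel))) ?B"
        by (subst has_integral_restrict_UNIV[symmetric])
          (simp add: indicator_def of_bool_def if_distrib if_distribR cong: if_cong)
      then have "F ` ?B \<in> lmeasurable" using iff by blast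
      then have "emeasure lborel (F ` ?B) < \<infinity>" using mFB by (simp add: fmeasurable_def)
      with False show False by blast
    qed
    with False show ?thesis by (simp add: not_less top_unique)
  qed
  finally show ?thesis using mFB by simp
qed

text \<open>The preceding lemma says that Lebesgue measure on the image of \<open>S\<close> and the
  image measure of the density \<open>(cmod (deriv f w))^2\<close> on \<open>S\<close> agree on
  Borel sets. Integrating \<open>h\<close> against both gives the formula.\<close>

lemma nn_integral_holomorphic_image:
  assumes S: "open S" "f holomorphic_on S" "inj_on f S" and [measurable]: "h \<in> borel_measurable borel"
  shows "(\<integral>\<^sup>+x. indicator (f ` S) x * h x \<partial>lborel)
       = (\<integral>\<^sup>+w. indicator S w * (ennreal ((cmod (deriv f w))\<^sup>2) * h (f w)) \<partial>lborel)"
proof -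
  have [measurable]: "S \<in> sets borel" using S by auto
  have opf: "open (f ` S)" using S open_mapping_thm3 by blast
  then have [measurable]: "f ` S \<in> sets borel" by auto
  \<comment> \<open>Extension by 0 makes the map Borel on the whole plane; points outside
    \<open>S\<close> carry no mass under the density \<open>?d\<close>.\<close>
  define f0 where "f0 = (\<lambda>w. if w \<in> S then f w else 0)"
  have [measurable]: "f0 \<in> borel_measurable borel"
    unfolding f0_def using S
    by (auto intro!: borel_measurable_continuous_on_if holomorphic_on_imp_continuous_on)
  have dS: "(\<lambda>w. indicator S w * ennreal ((cmod (deriv f w))\<^sup>2)) \<in> borel_measurable borel"
  proof -
    have "deriv f holomorphic_on S" using S by (simp add: holomorphic_deriv)
    then have "continuous_on S (\<lambda>w. ennreal ((cmod (deriv f w))\<^sup>2))"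
      by (intro continuous_on_ennreal continuous_on_power continuous_on_norm holomorphic_on_imp_continuous_on)
    then have "(\<lambda>w. ennreal ((cmod (deriv f w))\<^sup>2)) \<in> borel_measurable (restrict_space borel S)"
      by (rule borel_measurable_continuous_on_restrict)
    then show ?thesis
      using S(1) by (subst (asm) borel_measurable_restrict_space_iff_ennreal) (auto simp: mult.commute)
  qed
  let ?d = "\<lambda>w. indicator S w * ennreal ((cmod (deriv f w))\<^sup>2)"
  note dS[measurable]
  have eq: "density lborel (indicator (f ` S)) = distr (density lborel ?d) borel f0"
  proof (rule measure_eqI)
    fix X assume "X \<in> sets (density lborel (indicator (f ` S)))"
    then have X[measurable]: "X \<in> sets borel" by simp
    define B where "B = S \<inter> f0 -` X"
    have [measurable]: "B \<in> sets borel"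
      unfolding B_def using measurable_sets[OF \<open>f0 \<in> borel_measurable borel\<close> X] by auto
    have fB: "f ` B = f ` S \<inter> X" by (auto simp: B_def f0_def)
    have "emeasure (density lborel (indicator (f ` S))) X = emeasure lborel (f ` B)"
      by (simp add: emeasure_density indicator_inter_arith[symmetric] fB)
    also have "\<dots> = (\<integral>\<^sup>+w. indicator B w * ennreal ((cmod (deriv f w))\<^sup>2) \<partial>lborel)"
      using S fB by (intro emeasure_holomorphic_image[of S]) (auto simp: B_def[symmetric], auto simp: B_def)
    also have "\<dots> = emeasure (density lborel ?d) (f0 -` X)"
      using measurable_sets[OF \<open>f0 \<in> borel_measurable borel\<close> X]
      by (subst emeasure_density) (use dS in \<open>auto intro!: nn_integral_cong simp: B_def indicator_def\<close>)
    also have "\<dots> = emeasure (distr (density lborel ?d) borel f0) X"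
      by (subst emeasure_distr) auto
    finally show "emeasure (density lborel (indicator (f ` S))) X = emeasure (distr (density lborel ?d) borel f0) X" .
  qed simp
  have "(\<integral>\<^sup>+x. indicator (f ` S) x * h x \<partial>lborel) = (\<integral>\<^sup>+x. h x \<partial>density lborel (indicator (f ` S)))"
    by (subst nn_integral_density) auto
  also have "\<dots> = (\<integral>\<^sup>+w. ?d w * h (f0 w) \<partial>lborel)"
    unfolding eq by (subst nn_integral_distr) (auto simp: nn_integral_density)
  also have "\<dots> = (\<integral>\<^sup>+w. indicator S w * (ennreal ((cmod (deriv f w))\<^sup>2) * h (f w)) \<partial>lborel)"
    by (intro nn_integral_cong) (auto simp: indicator_def f0_def)
  finally show ?thesis .
qed

section \<open>Change of variables under the quadratic map\<close>

lemma borel_measurable_csqrt [measurable]: "csqrt \<in> borel_measurable borel"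
proof -
  have "csqrt = (\<lambda>z. complex_of_real (sqrt ((cmod z + Re z) / 2)) +
      \<i> * complex_of_real ((if Im z = 0 then 1 else sgn (Im z)) * sqrt ((cmod z - Re z) / 2)))"
    by (auto simp: fun_eq_iff complex_eq_iff)
  also have "\<dots> \<in> borel_measurable borel" by measurable
  finally show ?thesis .
qed

lemma AE_Im_neq: "AE x in lborel. Im x \<noteq> a"
proof -
  have "negligible {x::complex. \<i> \<bullet> x = a}" by (rule negligible_hyperplane) simp
  moreover have "{x::complex. \<i> \<bullet> x = a} = {x. Im x = a}" by (simp add: inner_complex_def)
  moreover have "closed {x. Im x = a}"
    by (intro closed_Collect_eq continuous_intros)
  ultimately have "{x. Im x = a} \<in> null_sets lborel"
    by (simp add: negligible_iff_null_sets null_sets_completion_iff)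
  then show ?thesis by (rule AE_I') auto
qed

lemma AE_Re_neq: "AE x in lborel. Re x \<noteq> a"
proof -
  have "negligible {x::complex. 1 \<bullet> x = a}" by (rule negligible_hyperplane) simp
  moreover have "{x::complex. 1 \<bullet> x = a} = {x. Re x = a}" by (simp add: inner_complex_def)
  moreover have "closed {x. Re x = a}"
    by (intro closed_Collect_eq continuous_intros)
  ultimately have "{x. Re x = a} \<in> null_sets lborel"
    by (simp add: negligible_iff_null_sets null_sets_completion_iff)
  then show ?thesis by (rule AE_I') auto
qed

lemma borel_measurable_quad [measurable]: "quad c \<in> borel_measurable borel"
  unfolding quad_def by measurable

lemma csqrt_eq_of_Re_pos: "Re w > 0 \<Longrightarrow> csqrt (w\<^sup>2) = w"
  by (rule csqrt_unique) auto

text \<open>\<open>quad c\<close> is injective on each of the half planes \<open>Re w > 0\<close>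
  and \<open>Re w < 0\<close>. Its inverse branches are the two signs of
  \<open>csqrt (x - c)\<close>, and the Jacobian at the preimage of \<open>x\<close> is
  \<open>4 * cmod (x - c)\<close>.\<close>

lemma nn_integral_quad_half:
  assumes [measurable]: "g \<in> borel_measurable borel" "\<phi> \<in> borel_measurable borel"
    and \<sigma>: "\<sigma> = 1 \<or> \<sigma> = -1"
  shows "(\<integral>\<^sup>+x. g x * (\<phi> (\<sigma> * csqrt (x - c)) * ennreal (1 / (4 * cmod (x - c)))) \<partial>lborel)
       = (\<integral>\<^sup>+w. indicator {w. Re (\<sigma> * w) > 0} w * (g (quad c w) * \<phi> w) \<partial>lborel)"
proof -
  let ?S = "{w. Re (\<sigma> * w) > 0}" and ?h = "\<lambda>x. g x * (\<phi> (\<sigma> * csqrt (x - c)) * ennreal (1 / (4 * cmod (x - c))))"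
  have sq: "(\<sigma> * w)\<^sup>2 = w\<^sup>2" "\<sigma> * (\<sigma> * w) = w" "\<sigma> \<noteq> 0" for w using \<sigma> by auto
  have cs: "csqrt (w\<^sup>2) = \<sigma> * w" if "w \<in> ?S" for w
    using csqrt_eq_of_Re_pos[of "\<sigma> * w"] that sq by simp
  have inj: "inj_on (quad c) ?S"
  proof (rule inj_onI)
    fix u w assume *: "u \<in> ?S" "w \<in> ?S" "quad c u = quad c w"
    then have "u\<^sup>2 = w\<^sup>2" by (simp add: quad_def)
    then have "\<sigma> * u = \<sigma> * w" using cs[OF *(1)] cs[OF *(2)] by metis
    then show "u = w" using \<sigma> by auto
  qed
  have "open ?S" by (intro open_Collect_less continuous_intros)
  have hol: "quad c holomorphic_on ?S" unfolding quad_def by (intro holomorphic_intros)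
  have der: "deriv (quad c) w = 2 * w" for w
    unfolding quad_def by (intro DERIV_imp_deriv) (auto intro!: derivative_eq_intros)
  \<comment> \<open>The image omits the ray where \<open>x - c\<close> is real and nonpositive. The
    whole horizontal line through \<open>c\<close> is discarded instead, which is still a null
    set.\<close>
  have img: "x \<in> quad c ` ?S" if "Im x \<noteq> Im c" for x
  proof -
    have "Im (x - c) = 2 * Re (csqrt (x - c)) * Im (csqrt (x - c))"
      by (metis Im_power2 power2_csqrt)
    then have "Re (csqrt (x - c)) \<noteq> 0" using that by auto
    then have "Re (csqrt (x - c)) > 0" using csqrt_principal[of "x - c"] by auto
    then have "\<sigma> * csqrt (x - c) \<in> ?S" using sq(2)[of "csqrt (x - c)"] by (metis mem_Collect_eq)
    moreover have "quad c (\<sigma> * csqrt (x - c)) = x" by (simp add: quad_def sq)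
    ultimately show ?thesis by (metis image_eqI)
  qed
  have "(\<integral>\<^sup>+x. ?h x \<partial>lborel) = (\<integral>\<^sup>+x. indicator (quad c ` ?S) x * ?h x \<partial>lborel)"
    using AE_Im_neq[of "Im c"] by (intro nn_integral_cong_AE) (auto elim!: eventually_mono dest!: img)
  also have "\<dots> = (\<integral>\<^sup>+w. indicator ?S w * (ennreal ((cmod (deriv (quad c) w))\<^sup>2) * ?h (quad c w)) \<partial>lborel)"
    by (rule nn_integral_holomorphic_image[OF \<open>open ?S\<close> hol inj]) measurable
  also have "\<dots> = (\<integral>\<^sup>+w. indicator ?S w * (g (quad c w) * \<phi> w) \<partial>lborel)"
  proof (rule nn_integral_cong)
    fix w
    show "indicator ?S w * (ennreal ((cmod (deriv (quad c) w))\<^sup>2) * ?h (quad c w)) 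
        = indicator ?S w * (g (quad c w) * \<phi> w)"
    proof (cases "w \<in> ?S")
      case True
      then have "w \<noteq> 0" by auto
      have e: "ennreal ((cmod (deriv (quad c) w))\<^sup>2) * ennreal (1 / (4 * cmod (w\<^sup>2))) = 1"
        using \<open>w \<noteq> 0\<close> by (simp add: der ennreal_mult'[symmetric] norm_mult norm_power power_mult_distrib)
      have "\<sigma> * csqrt (quad c w - c) = w" "quad c w - c = w\<^sup>2"
        using cs[OF True] sq(2) by (simp_all add: quad_def)
      then have "ennreal ((cmod (deriv (quad c) w))\<^sup>2) * ?h (quad c w)
         = g (quad c w) * \<phi> w * (ennreal ((cmod (deriv (quad c) w))\<^sup>2) * ennreal (1 / (4 * cmod (w\<^sup>2))))"
        by (simp only: ac_simps)
      then show ?thesis unfolding e by simp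
    qed simp
  qed
  finally show ?thesis .
qed

text \<open>The two half planes are added, the imaginary axis being null. The left side contains the
  transfer operator: the sum of \<phi> over the two preimages of \<open>x\<close>, divided by the
  squared modulus of the derivative there.\<close>

lemma nn_integral_quad:
  assumes [measurable]: "g \<in> borel_measurable borel" "\<phi> \<in> borel_measurable borel"
  shows "(\<integral>\<^sup>+x. g x * ((\<phi> (csqrt (x - c)) + \<phi> (- csqrt (x - c))) * ennreal (1 / (4 * cmod (x - c)))) \<partial>lborel)
       = (\<integral>\<^sup>+w. g (quad c w) * \<phi> w \<partial>lborel)"
proof -
  have "(\<integral>\<^sup>+w. g (quad c w) * \<phi> w \<partial>lborel) = 
     (\<integral>\<^sup>+w. indicator {w. Re (1 * w) > 0} w * (g (quad c w) * \<phi> w) 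
          + indicator {w. Re (-1 * w) > 0} w * (g (quad c w) * \<phi> w) \<partial>lborel)"
    using AE_Re_neq[of 0] by (intro nn_integral_cong_AE) (auto elim!: eventually_mono simp: indicator_def)
  also have "\<dots> = (\<integral>\<^sup>+x. g x * (\<phi> (1 * csqrt (x - c)) * ennreal (1 / (4 * cmod (x - c)))) \<partial>lborel)
      + (\<integral>\<^sup>+x. g x * (\<phi> (-1 * csqrt (x - c)) * ennreal (1 / (4 * cmod (x - c)))) \<partial>lborel)"
    unfolding nn_integral_quad_half[OF assms disjI1[OF refl]] nn_integral_quad_half[OF assms disjI2[OF refl]]
    by (rule nn_integral_add) measurable
  also have "\<dots> = (\<integral>\<^sup>+x. g x * ((\<phi> (csqrt (x - c)) + \<phi> (- csqrt (x - c))) * ennreal (1 / (4 * cmod (x - c)))) \<partial>lborel)"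
    by (subst nn_integral_add[symmetric]) (auto intro!: nn_integral_cong simp: algebra_simps)
  finally show ?thesis by simp
qed

section \<open>Logarithmic polar coordinates on annuli\<close>

text \<open>The substitution \<open>x = p + exp (2 * pi * \<zeta>)\<close> turns the annulus, cut
  along a ray, into a rectangle. The factor \<open>2 * pi\<close> lets the angle run over a unit
  interval, as in the parametrisation of \<open>circlepath\<close>.\<close>

lemma nn_integral_annulus:
  assumes ab: "0 < a" "a < b" and [measurable]: "h \<in> borel_measurable borel"
  shows "(\<integral>\<^sup>+x. indicator {x. a < cmod (x - p) \<and> cmod (x - p) < b} x * h x \<partial>lborel)
    = (\<integral>\<^sup>+s. \<integral>\<^sup>+t. indicator {ln a / (2 * pi)<..<ln b / (2 * pi)} s * (indicator {0<..<1} t * 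
        (ennreal ((2 * pi * exp (2 * pi * s))\<^sup>2) * h (p + exp (2 * of_real pi * Complex s t)))) \<partial>lborel \<partial>lborel)"
proof -
  let ?E = "\<lambda>\<zeta>. p + exp (2 * of_real pi * \<zeta>)"
  let ?S = "{ln a / (2 * pi)<..<ln b / (2 * pi)}"
  let ?R = "{\<zeta>. Re \<zeta> \<in> ?S \<and> Im \<zeta> \<in> {0<..<1}}"
  have "open ?R"
    unfolding greaterThanLessThan_iff by (intro open_Collect_conj open_Collect_less continuous_intros)
  then have [measurable]: "?R \<in> sets borel" by simp
  have hol: "?E holomorphic_on ?R" by (intro holomorphic_intros)
  have inj: "inj_on ?E ?R"
  proof (rule inj_onI)
    fix u w assume *: "u \<in> ?R" "w \<in> ?R" "?E u = ?E w"
    then have "exp (2 * of_real pi * u) = exp (2 * of_real pi * w)" by simp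
    moreover have "\<bar>Im (2 * of_real pi * u) - Im (2 * of_real pi * w)\<bar> < 2 * pi"
    proof -
      have "\<bar>Im u - Im w\<bar> < 1" using * by auto
      then have "2 * pi * \<bar>Im u - Im w\<bar> < 2 * pi * 1" by (intro mult_strict_left_mono) auto
      moreover have "Im (2 * of_real pi * u) - Im (2 * of_real pi * w) = 2 * pi * (Im u - Im w)"
        by (simp add: right_diff_distrib)
      ultimately show ?thesis by (simp only: abs_mult) simp
    qed
    ultimately have "2 * of_real pi * u = 2 * of_real pi * w"
      by (rule exp_complex_eqI[rotated])
    moreover have "2 * of_real pi \<noteq> (0::complex)" by simp
    ultimately show "u = w" by (metis mult_left_cancel)
  qed
  have der: "deriv ?E \<zeta> = 2 * of_real pi * exp (2 * of_real pi * \<zeta>)" for \<zeta>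
    by (intro DERIV_imp_deriv) (auto intro!: derivative_eq_intros)
  have Rmem: "Re \<zeta> \<in> ?S \<longleftrightarrow> a < cmod (exp (2 * of_real pi * \<zeta>)) \<and> cmod (exp (2 * of_real pi * \<zeta>)) < b" for \<zeta>
  proof -
    have "a < exp (2 * pi * Re \<zeta>) \<longleftrightarrow> ln a < 2 * pi * Re \<zeta>"
      using ab by (metis exp_less_cancel_iff exp_ln)
    moreover have "exp (2 * pi * Re \<zeta>) < b \<longleftrightarrow> 2 * pi * Re \<zeta> < ln b"
      using ab by (metis exp_less_cancel_iff exp_ln less_trans)
    ultimately show ?thesis by (simp add: field_simps)
  qed
  have img: "x \<in> ?E ` ?R \<longleftrightarrow> a < cmod (x - p) \<and> cmod (x - p) < b" if "Im x \<noteq> Im p" for x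
  proof
    assume "x \<in> ?E ` ?R"
    then obtain \<zeta> where "\<zeta> \<in> ?R" "x = ?E \<zeta>" by blast
    then show "a < cmod (x - p) \<and> cmod (x - p) < b"
      using Rmem[of \<zeta>] by simp
  next
    assume *: "a < cmod (x - p) \<and> cmod (x - p) < b"
    \<comment> \<open>The argument of \<open>- (x - p)\<close> lies in \<open>(-pi, pi]\<close>;
      after division by \<open>2 * pi\<close> and the shift by 1/2 it lies in \<open>(0, 1]\<close>.
      The endpoint 1 is ruled out by \<open>Im x \<noteq> Im p\<close>.\<close>
    let ?z = "Ln (- (x - p)) / (2 * of_real pi) + \<i> / 2"
    have ne: "x - p \<noteq> 0" using that by auto
    have e: "exp (2 * of_real pi * ?z) = x - p"
    proof -
      have "2 * of_real pi * ?z = Ln (- (x - p)) + of_real pi * \<i>"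
        by (simp add: field_simps)
      then show ?thesis using ne by (simp only: exp_add exp_pi_i' exp_Ln neg_equal_0_iff_equal) simp
    qed
    have 1: "Im (Ln (- (x - p))) < pi" 
    proof -
      have "Im (Ln (- (x - p))) \<noteq> pi"
      proof
        assume "Im (Ln (- (x - p))) = pi"
        then have "Im (- (x - p)) = 0" using ne by (subst (asm) Im_Ln_eq_pi) auto
        with that show False by simp
      qed
      then show ?thesis using Im_Ln_le_pi[of "- (x - p)"] ne by simp
    qed
    have 2: "- pi < Im (Ln (- (x - p)))" using mpi_less_Im_Ln[of "- (x - p)"] ne by simp
    have imz: "Im ?z = Im (Ln (- (x - p))) / (2 * pi) + 1 / 2" 
      using Im_divide_of_real[of "Ln (- (x - p))" "2 * pi"] by simp
    have "Im ?z \<in> {0<..<1}" using 1 2 unfolding imz by (auto simp: field_simps)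
    moreover have "Re ?z \<in> ?S" using Rmem[of ?z] * unfolding e by blast
    ultimately have "?z \<in> ?R" by blast
    moreover have "x = ?E ?z" using e by simp
    ultimately show "x \<in> ?E ` ?R" by blast
  qed
  have ex: "(\<lambda>\<zeta>. exp (2 * of_real pi * \<zeta> :: complex)) \<in> borel_measurable borel"
    by (intro borel_measurable_continuous_onI continuous_intros)
  note ex[measurable]
  have "(\<integral>\<^sup>+x. indicator {x. a < cmod (x - p) \<and> cmod (x - p) < b} x * h x \<partial>lborel)
     = (\<integral>\<^sup>+x. indicator (?E ` ?R) x * h x \<partial>lborel)"
  proof (rule nn_integral_cong_AE, rule eventually_mono[OF AE_Im_neq[of "Im p"]])
    fix x assume "Im x \<noteq> Im p"
    from img[OF this] have "indicator {x. a < cmod (x - p) \<and> cmod (x - p) < b} x = (indicator (?E ` ?R) x :: ennreal)"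
      unfolding indicator_def by (simp only: mem_Collect_eq)
    then show "indicator {x. a < cmod (x - p) \<and> cmod (x - p) < b} x * h x = indicator (?E ` ?R) x * h x"
      by (simp only:)
  qed
  also have "\<dots> = (\<integral>\<^sup>+\<zeta>. indicator ?R \<zeta> * (ennreal ((cmod (deriv ?E \<zeta>))\<^sup>2) * h (?E \<zeta>)) \<partial>lborel)"
    by (rule nn_integral_holomorphic_image[OF \<open>open ?R\<close> hol inj]) measurable
  also have "\<dots> = (\<integral>\<^sup>+s. \<integral>\<^sup>+t. indicator ?R (Complex s t) * 
      (ennreal ((cmod (deriv ?E (Complex s t)))\<^sup>2) * h (?E (Complex s t))) \<partial>lborel \<partial>lborel)"
    unfolding der by (rule nn_integral_complex_iterated) measurable
  also have "\<dots> = (\<integral>\<^sup>+s. \<integral>\<^sup>+t. indicator ?S s * (indicator {0<..<1} t * 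
        (ennreal ((2 * pi * exp (2 * pi * s))\<^sup>2) * h (?E (Complex s t)))) \<partial>lborel \<partial>lborel)"
    unfolding der by (intro nn_integral_cong) (auto simp: indicator_def norm_mult)
  finally show ?thesis .
qed

text \<open>In logarithmic coordinates the weight cancels the exponential factor of the Jacobian, so
  a constant is integrated over a rectangle.\<close>

lemma nn_integral_annulus_inverse_square:
  assumes ab: "0 < a" "a < b"
  shows "(\<integral>\<^sup>+x. indicator {x. a < cmod (x - p) \<and> cmod (x - p) < b} x * ennreal (1 / (cmod (x - p))\<^sup>2) \<partial>lborel)
    = ennreal (2 * pi * (ln b - ln a))"
proof -
  have "(\<integral>\<^sup>+x. indicator {x. a < cmod (x - p) \<and> cmod (x - p) < b} x * ennreal (1 / (cmod (x - p))\<^sup>2) \<partial>lborel)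
    = (\<integral>\<^sup>+s. \<integral>\<^sup>+t. ennreal ((2 * pi)\<^sup>2) * indicator {ln a / (2 * pi)<..<ln b / (2 * pi)} s * indicator {0<..<1::real} t \<partial>lborel \<partial>lborel)"
    by (subst nn_integral_annulus[OF ab], measurable)
      (auto intro!: nn_integral_cong simp: indicator_def ennreal_mult'[symmetric] power_mult_distrib)
  also have "\<dots> = ennreal ((2 * pi)\<^sup>2) * ennreal (ln b / (2 * pi) - ln a / (2 * pi))"
    using ab by (simp add: nn_integral_cmult divide_right_mono)
  also have "\<dots> = ennreal (2 * pi * (ln b - ln a))"
  proof -
    have "(2 * pi)\<^sup>2 * (ln b / (2 * pi) - ln a / (2 * pi)) = 2 * pi * (ln b - ln a)"
      by (simp add: field_simps power2_eq_square)
    then show ?thesis by (metis ennreal_mult' zero_le_power2)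
  qed
  finally show ?thesis .
qed

section \<open>Green function, multipliers and the size of the parameter\<close>

lemma iterate_Suc: "(quad c ^^ Suc k) z = ((quad c ^^ k) z)\<^sup>2 + c"
proof -
  have "(quad c ^^ Suc k) z = quad c ((quad c ^^ k) z)" by simp
  also have "\<dots> = ((quad c ^^ k) z)\<^sup>2 + c" by (rule quad_def)
  finally show ?thesis .
qed

text \<open>With moduli cut off below at 1, one step squares the modulus up to a factor
  \<open>1 + cmod c\<close> in either direction.\<close>

lemma ln_quad_step:
  "\<bar>ln (max 1 (cmod (quad c z))) - 2 * ln (max 1 (cmod z))\<bar> \<le> ln (1 + cmod c)"
proof -
  have 1: "max 1 (cmod (quad c z)) \<le> (1 + cmod c) * (max 1 (cmod z))\<^sup>2"
  proof -
    have m: "1 \<le> (max 1 (cmod z))\<^sup>2" "(cmod z)\<^sup>2 \<le> (max 1 (cmod z))\<^sup>2"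
      by (auto intro: power_mono)
    have "cmod (quad c z) \<le> (cmod z)\<^sup>2 + cmod c"
      unfolding quad_def by (metis norm_triangle_ineq norm_power)
    also have "\<dots> \<le> (max 1 (cmod z))\<^sup>2 + cmod c * (max 1 (cmod z))\<^sup>2"
      using add_mono[OF m(2) mult_left_mono[OF m(1), of "cmod c"]] by simp
    finally have "cmod (quad c z) \<le> (1 + cmod c) * (max 1 (cmod z))\<^sup>2" by (simp add: algebra_simps)
    moreover have "1 * 1 \<le> (1 + cmod c) * (max 1 (cmod z))\<^sup>2"
      by (rule mult_mono) (use m in auto)
    ultimately show ?thesis by simp
  qed
  have 2: "(max 1 (cmod z))\<^sup>2 \<le> (1 + cmod c) * max 1 (cmod (quad c z))"
  proof -
    have "(cmod z)\<^sup>2 = cmod (quad c z - c)" by (simp add: quad_def norm_power)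
    also have "\<dots> \<le> cmod (quad c z) + cmod c" by (rule norm_triangle_ineq4)
    also have "\<dots> \<le> max 1 (cmod (quad c z)) + cmod c * max 1 (cmod (quad c z))"
      using mult_left_mono[of 1 "max 1 (cmod (quad c z))" "cmod c"] by simp
    finally have "(cmod z)\<^sup>2 \<le> (1 + cmod c) * max 1 (cmod (quad c z))" by (simp add: algebra_simps)
    moreover have "1 * 1 \<le> (1 + cmod c) * max 1 (cmod (quad c z))"
      by (rule mult_mono) auto
    ultimately show ?thesis by (cases "cmod z \<le> 1") (auto simp: max_def)
  qed
  have pos: "0 < max 1 (cmod (quad c z))" "0 < max 1 (cmod z)" "0 < 1 + cmod c"
    by (auto simp: add_pos_nonneg)
  have "ln (max 1 (cmod (quad c z))) \<le> ln ((1 + cmod c) * (max 1 (cmod z))\<^sup>2)"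
    using 1 pos by (subst ln_le_cancel_iff) auto
  moreover have "ln ((max 1 (cmod z))\<^sup>2) \<le> ln ((1 + cmod c) * max 1 (cmod (quad c z)))"
    using 2 pos by (subst ln_le_cancel_iff) auto
  moreover have "ln ((max 1 (cmod z))\<^sup>2) = 2 * ln (max 1 (cmod z))"
    using pos by (simp add: ln_realpow)
  ultimately show ?thesis using pos by (simp add: ln_mult ln_realpow)
qed

text \<open>Both claims come from one telescoping series: the \<open>k\<close>-th increment is at
  most \<open>ln (1 + cmod c) / 2 ^ Suc k\<close>, and these bounds add up to
  \<open>ln (1 + cmod c)\<close>.\<close>

lemma green_approx_aux:
  defines "u \<equiv> (\<lambda>c z k. ln (max 1 (cmod ((quad c ^^ k) z))) / 2 ^ k)"
  shows "u c z \<longlonglongrightarrow> green c z" "\<bar>green c z - ln (max 1 (cmod z))\<bar> \<le> ln (1 + cmod c)"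
proof -
  define d where "d = (\<lambda>k. u c z (Suc k) - u c z k)"
  have d: "\<bar>d k\<bar> \<le> ln (1 + cmod c) / 2 * (1 / 2) ^ k" for k
  proof -
    have "d k = (ln (max 1 (cmod (quad c ((quad c ^^ k) z)))) - 2 * ln (max 1 (cmod ((quad c ^^ k) z)))) / 2 ^ Suc k"
      by (simp add: d_def u_def field_simps)
    then have "\<bar>d k\<bar> = \<bar>ln (max 1 (cmod (quad c ((quad c ^^ k) z)))) - 2 * ln (max 1 (cmod ((quad c ^^ k) z)))\<bar> / 2 ^ Suc k"
      by (simp add: abs_divide)
    also have "\<dots> \<le> ln (1 + cmod c) / 2 ^ Suc k"
      by (intro divide_right_mono ln_quad_step) auto
    finally show ?thesis by (simp add: power_one_over)
  qed
  have geo: "(\<lambda>k. ln (1 + cmod c) / 2 * (1 / 2) ^ k) sums (ln (1 + cmod c) / 2 * (1 / (1 - 1 / 2)))"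
    by (intro sums_mult geometric_sums) auto
  have sm: "summable (\<lambda>k. \<bar>d k\<bar>)"
    by (rule summable_comparison_test[OF _ sums_summable[OF geo]]) (use d in auto)
  then have "summable d" by (rule summable_rabs_cancel)
  then have "(\<lambda>n. \<Sum>k<n. d k) \<longlonglongrightarrow> suminf d" by (rule summable_LIMSEQ)
  moreover have "(\<Sum>k<n. d k) = u c z n - u c z 0" for n
    unfolding d_def by (rule sum_lessThan_telescope)
  ultimately have "(\<lambda>n. u c z n - u c z 0 + u c z 0) \<longlonglongrightarrow> suminf d + u c z 0"
    by (intro tendsto_add) auto
  then have lim: "u c z \<longlonglongrightarrow> suminf d + u c z 0" by simp
  then have g: "green c z = suminf d + u c z 0"
    unfolding green_def u_def by (rule limI)
  with lim show "u c z \<longlonglongrightarrow> green c z" by simp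
  have "\<bar>suminf d\<bar> \<le> (\<Sum>k. \<bar>d k\<bar>)" by (rule summable_rabs[OF sm])
  also have "\<dots> \<le> (\<Sum>k. ln (1 + cmod c) / 2 * (1 / 2) ^ k)"
    by (rule suminf_le[OF d sm sums_summable[OF geo]])
  also have "\<dots> = ln (1 + cmod c)" using sums_unique[OF geo] by simp
  finally show "\<bar>green c z - ln (max 1 (cmod z))\<bar> \<le> ln (1 + cmod c)"
    unfolding g by (simp add: u_def)
qed

lemmas green_LIMSEQ = green_approx_aux(1)
  and green_approx = green_approx_aux(2)

lemma green_nonneg: "green c z \<ge> 0"
  by (rule LIMSEQ_le_const[OF green_LIMSEQ]) auto

lemma green_quad: "green c (quad c z) = 2 * green c z"
proof -
  have "(\<lambda>k. 2 * (ln (max 1 (cmod ((quad c ^^ Suc k) z))) / 2 ^ Suc k)) \<longlonglongrightarrow> 2 * green c z"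
    by (intro tendsto_mult tendsto_const LIMSEQ_Suc[OF green_LIMSEQ])
  then have "(\<lambda>k. ln (max 1 (cmod ((quad c ^^ k) (quad c z)))) / 2 ^ k) \<longlonglongrightarrow> 2 * green c z"
    by (simp add: funpow_swap1)
  then show ?thesis using green_LIMSEQ LIMSEQ_unique by blast
qed

lemma green_iterate: "green c ((quad c ^^ k) z) = 2 ^ k * green c z"
  by (induction k) (auto simp: green_quad)

lemma continuous_on_iterate: "continuous_on S (quad c ^^ k)"
proof (induction k)
  case (Suc k)
  then have "continuous_on S (\<lambda>z. ((quad c ^^ k) z)\<^sup>2 + c)" by (intro continuous_intros)
  then show ?case by (simp only: iterate_Suc[abs_def])
qed (simp add: id_def)

text \<open>\<open>green_approx\<close> at the \<open>k\<close>-th iterate, divided by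
  \<open>2 ^ k\<close>, bounds the error of the \<open>k\<close>-th approximant uniformly in the
  point.\<close>

lemma continuous_on_green: "continuous_on S (green c)"
proof -
  define \<gamma> where "\<gamma> = ln (1 + cmod c)"
  let ?u = "\<lambda>k z. ln (max 1 (cmod ((quad c ^^ k) z))) / 2 ^ k"
  have bd: "\<bar>?u k z - green c z\<bar> \<le> \<gamma> * (1/2) ^ k" for k z
  proof -
    have "?u k z - green c z = - (green c ((quad c ^^ k) z) - ln (max 1 (cmod ((quad c ^^ k) z)))) / 2 ^ k"
      by (simp add: green_iterate field_simps)
    then have "\<bar>?u k z - green c z\<bar> = \<bar>green c ((quad c ^^ k) z) - ln (max 1 (cmod ((quad c ^^ k) z)))\<bar> / 2 ^ k"
      by (simp add: abs_divide)
    also have "\<dots> \<le> \<gamma> / 2 ^ k"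
      unfolding \<gamma>_def by (intro divide_right_mono green_approx) auto
    finally show ?thesis by (simp add: power_one_over)
  qed
  have "(\<lambda>k. \<gamma> * (1/2) ^ k) \<longlonglongrightarrow> \<gamma> * 0"
    by (intro tendsto_mult tendsto_const LIMSEQ_realpow_zero) auto
  then have ev: "\<forall>\<^sub>F k in sequentially. \<gamma> * (1/2) ^ k < e" if "e > 0" for e
    using that by (auto dest!: order_tendstoD(2))
  have "uniform_limit S ?u (green c) sequentially"
    by (rule uniform_limitI, rule eventually_mono[OF ev])
      (use bd in \<open>auto simp: dist_real_def intro: le_less_trans\<close>)
  moreover have "\<forall>\<^sub>F k in sequentially. continuous_on S (?u k)"
    by (intro always_eventually allI continuous_intros continuous_on_iterate) auto
  ultimately show ?thesis
    by (intro uniform_limit_theorem[of S ?u sequentially]) auto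
qed

lemma green_periodic: "n \<ge> 1 \<Longrightarrow> (quad c ^^ n) z = z \<Longrightarrow> green c z = 0"
  using green_iterate[of c n z] one_less_power[of "2::real" n] by (simp del: one_less_power)

section \<open>Growth of orbits and derivatives in terms of \<open>beta\<close>\<close>

lemma beta_eq: "beta c = (1 + sqrt (1 + 4 * cmod c)) / 2"
  unfolding beta_def
proof (rule the_equality)
  let ?s = "sqrt (1 + 4 * cmod c)"
  have "?s\<^sup>2 = 1 + 4 * cmod c" by simp
  moreover have "?s \<ge> 1" by simp
  ultimately show "(1 + ?s) / 2 > 0 \<and> ((1 + ?s) / 2)\<^sup>2 - cmod c = (1 + ?s) / 2"
    by (auto simp: field_simps power2_eq_square intro: add_pos_nonneg)
  fix b assume b: "b > 0 \<and> b\<^sup>2 - cmod c = b"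
  then have "(2 * b - 1)\<^sup>2 = 1 + 4 * cmod c" by (simp add: power2_eq_square algebra_simps)
  moreover have "b \<ge> 1"
  proof (rule ccontr)
    assume "\<not> b \<ge> 1"
    then have "b * b < b * 1" using b by (intro mult_strict_left_mono) auto
    moreover have "b * b = b + cmod c" using b by (simp add: power2_eq_square)
    ultimately show False using norm_ge_zero[of c] by linarith
  qed
  ultimately have "?s = 2 * b - 1" by (intro real_sqrt_unique) auto
  then show "b = (1 + ?s) / 2" by simp
qed

lemma beta_ge_1: "beta c \<ge> 1" and beta_square: "(beta c)\<^sup>2 = beta c + cmod c"
proof -
  let ?s = "sqrt (1 + 4 * cmod c)"
  have "?s\<^sup>2 = 1 + 4 * cmod c" by simp
  moreover have "?s \<ge> 1" by simp
  ultimately show "beta c \<ge> 1" "(beta c)\<^sup>2 = beta c + cmod c"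
    unfolding beta_eq by (auto simp: field_simps power2_eq_square)
qed

text \<open>\<open>beta c\<close> is the positive fixed point of the map sending \<open>t\<close> to
  \<open>t^2 - cmod c\<close>. A point of modulus \<open>t * beta c\<close> with
  \<open>t \<ge> 1\<close> has an image of modulus at least \<open>t^2 * beta c\<close>, because
  \<open>(t^2 - 1) * beta c * (beta c - 1) \<ge> 0\<close>.\<close>

lemma norm_iterate_lower:
  assumes "cmod z \<ge> beta c"
  shows "(cmod z / beta c) ^ (2 ^ k) \<le> cmod ((quad c ^^ k) z) / beta c"
proof (induction k)
  case (Suc k)
  define b where "b = beta c"
  let ?y = "(quad c ^^ k) z"
  have b: "b \<ge> 1" "b\<^sup>2 = b + cmod c" by (simp_all add: b_def beta_ge_1 beta_square)
  define t where "t = cmod ?y / b"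
  have "1 \<le> (cmod z / b) ^ (2 ^ k)" using assms b by (intro one_le_power) (auto simp: b_def[symmetric])
  then have t: "t \<ge> 1" using Suc by (simp add: t_def b_def)
  have "(cmod z / b) ^ (2 ^ Suc k) = ((cmod z / b) ^ (2 ^ k))\<^sup>2"
    by (simp add: power_mult[symmetric] mult.commute)
  also have "\<dots> \<le> t\<^sup>2" using Suc b unfolding t_def b_def by (intro power_mono) auto
  also have "t\<^sup>2 * b \<le> cmod (quad c ?y)"
  proof -
    have "cmod (?y\<^sup>2) \<le> cmod (quad c ?y) + cmod c"
      unfolding quad_def by (metis add_diff_cancel_right' norm_triangle_ineq4)
    then have "(t * b)\<^sup>2 \<le> cmod (quad c ?y) + (b\<^sup>2 - b)"
      using b by (simp add: t_def norm_power)
    moreover have "t\<^sup>2 * b \<le> (t * b)\<^sup>2 - (b\<^sup>2 - b)"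
    proof -
      have "0 \<le> (t\<^sup>2 - 1) * (b * (b - 1))" using t b by (intro mult_nonneg_nonneg) auto
      then show ?thesis by (simp add: power2_eq_square algebra_simps)
    qed
    ultimately show ?thesis by linarith
  qed
  then have "t\<^sup>2 \<le> cmod (quad c ?y) / b" using b by (simp add: field_simps)
  finally show ?case by (simp add: b_def)
qed simp

text \<open>Outside the radius \<open>beta c\<close> this is the limit of the preceding estimate
  after taking logarithms and dividing by \<open>2 ^ k\<close>; inside it follows from
  \<open>green_nonneg\<close>.\<close>

lemma norm_le_beta_green: "cmod z \<le> beta c * exp (green c z)"
proof (cases "cmod z \<ge> beta c")
  case True
  define b where "b = beta c"
  have b: "b \<ge> 1" by (simp add: b_def beta_ge_1)
  have "ln (cmod z / b) \<le> ln (max 1 (cmod ((quad c ^^ k) z))) / 2 ^ k" for k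
  proof -
    have pos: "cmod z / b > 0" using True b by (intro divide_pos_pos) (auto simp: b_def)
    have "(cmod z / b) ^ (2 ^ k) \<le> cmod ((quad c ^^ k) z) / b"
      using norm_iterate_lower[OF True] by (simp add: b_def)
    also have "\<dots> \<le> cmod ((quad c ^^ k) z)" using b mult_left_mono[OF b, of "cmod ((quad c ^^ k) z)"] by (simp add: divide_le_eq)
    also have "\<dots> \<le> max 1 (cmod ((quad c ^^ k) z))" by simp
    finally have "ln ((cmod z / b) ^ (2 ^ k)) \<le> ln (max 1 (cmod ((quad c ^^ k) z)))"
      using pos by (subst ln_le_cancel_iff) auto
    then have "2 ^ k * ln (cmod z / b) \<le> ln (max 1 (cmod ((quad c ^^ k) z)))"
      using pos by (simp add: ln_realpow)
    then show ?thesis by (simp add: field_simps)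
  qed
  then have "ln (cmod z / b) \<le> green c z"
    by (intro LIMSEQ_le_const[OF green_LIMSEQ]) auto
  moreover have "cmod z / b > 0" using True b by (intro divide_pos_pos) (auto simp: b_def)
  ultimately have "cmod z / b \<le> exp (green c z)"
    by (metis exp_le_cancel_iff exp_ln)
  then show ?thesis using b by (simp add: b_def[symmetric] field_simps)
next
  case False
  have "beta c * 1 \<le> beta c * exp (green c z)"
    using beta_ge_1[of c] green_nonneg[of c z] by (intro mult_left_mono) auto
  then show ?thesis using False by simp
qed

lemma has_field_derivative_iterate:
  "((quad c ^^ n) has_field_derivative (\<Prod>k<n. 2 * (quad c ^^ k) z)) (at z)"
proof (induction n)
  case (Suc n)
  have "((\<lambda>z. ((quad c ^^ n) z)\<^sup>2 + c) has_field_derivative (\<Prod>k<Suc n. 2 * (quad c ^^ k) z)) (at z)"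
    by (rule derivative_eq_intros Suc refl)+ (simp add: mult_ac)
  then show ?case by (simp only: iterate_Suc[abs_def])
qed (simp add: id_def)

lemma deriv_iterate: "deriv (quad c ^^ n) z = (\<Prod>k<n. 2 * (quad c ^^ k) z)"
  by (rule DERIV_imp_deriv[OF has_field_derivative_iterate])

text \<open>Each factor of the chain rule is bounded by \<open>norm_le_beta_green\<close>. The
  exponents \<open>2 ^ k * green c z\<close> for \<open>k < n\<close> add up to the difference of
  the Green values at the two ends.\<close>

lemma norm_deriv_iterate_le:
  "cmod (deriv (quad c ^^ n) z) \<le> (2 * beta c) ^ n * exp (green c ((quad c ^^ n) z) - green c z)"
proof (induction n)
  case (Suc n)
  let ?y = "(quad c ^^ n) z"
  have "cmod (deriv (quad c ^^ Suc n) z) = cmod (deriv (quad c ^^ n) z) * (2 * cmod ?y)"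
    by (simp add: deriv_iterate norm_mult del: funpow.simps)
  also have "\<dots> \<le> ((2 * beta c) ^ n * exp (green c ?y - green c z)) * (2 * (beta c * exp (green c ?y)))"
    using beta_ge_1[of c] by (intro mult_mono Suc norm_le_beta_green) auto
  also have "\<dots> = (2 * beta c) ^ Suc n * exp (green c ?y - green c z + green c ?y)"
    unfolding exp_add by simp
  also have "green c ?y - green c z + green c ?y = green c ((quad c ^^ Suc n) z) - green c z"
    by (simp add: green_quad)
  finally show ?case .
qed simp

text \<open>For \<open>\<bar>c\<bar> = R > 2\<close> the map expands the metric \<open>\<bar>dz\<bar> / (R\<^sup>2 - \<bar>z\<bar>\<^sup>2)\<close> on the preimage of the
  disc of radius \<open>R\<close>.\<close>

lemma quad_expansion_step:
  assumes R: "cmod c > 2" and z: "cmod z < cmod c" "cmod (quad c z) < cmod c"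
  shows "sqrt (cmod c / 2) * ((cmod c)\<^sup>2 - (cmod (quad c z))\<^sup>2) \<le> 2 * cmod z * ((cmod c)\<^sup>2 - (cmod z)\<^sup>2)"
proof -
  define R s where "R = cmod c" and "s = cmod z"
  have s2: "s\<^sup>2 < 2 * R"
  proof -
    have "s\<^sup>2 = cmod (quad c z - c)" by (simp add: quad_def norm_power s_def)
    also have "\<dots> \<le> cmod (quad c z) + cmod c" by (rule norm_triangle_ineq4)
    finally show ?thesis using z by (simp add: R_def)
  qed
  have s0: "s \<ge> 0" by (simp add: s_def)
  \<comment> \<open>The modulus of the image is smallest when \<open>z^2\<close> points opposite to
    \<open>c\<close>, where it equals the distance of \<open>s^2\<close> from
    \<open>R\<close>.\<close>
  have low: "R\<^sup>2 - (cmod (quad c z))\<^sup>2 \<le> s\<^sup>2 * (2 * R - s\<^sup>2)"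
  proof -
    have "R - s\<^sup>2 \<le> cmod (quad c z)" "s\<^sup>2 - R \<le> cmod (quad c z)"
      using norm_triangle_ineq2[of c "-z\<^sup>2"] norm_triangle_ineq2[of "z\<^sup>2" "-c"]
      by (simp_all add: R_def s_def quad_def norm_power add.commute)
    then have "(R - s\<^sup>2)\<^sup>2 \<le> (cmod (quad c z))\<^sup>2" by (intro power2_le_iff_abs_le[THEN iffD2]) auto
    then show ?thesis by (simp add: power2_eq_square algebra_simps)
  qed
  have ks: "sqrt (R / 2) * s \<le> R"
  proof -
    have "s \<le> sqrt (2 * R)" using s2 s0 by (intro real_le_rsqrt) simp
    then have "sqrt (R / 2) * s \<le> sqrt (R / 2) * sqrt (2 * R)"
      using R by (intro mult_left_mono) (auto simp: R_def)
    also have "\<dots> = R" using R by (simp add: real_sqrt_mult[symmetric] R_def)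
    finally show ?thesis .
  qed
  have "sqrt (R / 2) * (R\<^sup>2 - (cmod (quad c z))\<^sup>2) \<le> sqrt (R / 2) * (s\<^sup>2 * (2 * R - s\<^sup>2))"
    using low R by (intro mult_left_mono) (auto simp: R_def)
  also have "\<dots> = (sqrt (R / 2) * s) * (s * (2 * R - s\<^sup>2))"
    by (simp add: power2_eq_square algebra_simps)
  also have "\<dots> \<le> R * (s * (2 * R - s\<^sup>2))"
    using ks s2 s0 by (intro mult_right_mono) auto
  also have "\<dots> = 2 * s * (R / 2 * (2 * R - s\<^sup>2))" by simp
  also have "\<dots> \<le> 2 * s * (R\<^sup>2 - s\<^sup>2)"
  proof -
    have "0 \<le> s\<^sup>2 * (R / 2 - 1)" using R by (intro mult_nonneg_nonneg) (auto simp: R_def)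
    then have "R / 2 * (2 * R - s\<^sup>2) \<le> R\<^sup>2 - s\<^sup>2" by (simp add: power2_eq_square algebra_simps)
    then show ?thesis using s0 by (intro mult_left_mono) auto
  qed
  finally show ?thesis by (simp add: R_def s_def)
qed

lemma norm_periodic_le_beta:
  assumes "n \<ge> 1" "(quad c ^^ n) z = z"
  shows "cmod ((quad c ^^ k) z) \<le> beta c"
  using norm_le_beta_green[of "(quad c ^^ k) z" c] green_periodic[OF assms] by (simp add: green_iterate)

lemma beta_less_norm: "cmod c > 2 \<Longrightarrow> beta c < cmod c"
proof (rule ccontr)
  assume c: "cmod c > 2" and "\<not> beta c < cmod c"
  then have "beta c \<ge> cmod c" by simp
  then have "beta c * beta c \<le> 2 * beta c" using beta_square[of c] by (simp add: power2_eq_square)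
  then have "beta c \<le> 2" using beta_ge_1[of c] by simp
  then show False using c \<open>beta c \<ge> cmod c\<close> by simp
qed

text \<open>The expansion factors multiply along the cycle, and the metric densities at its two ends
  cancel because the ends coincide. The cycle stays in the disc where the metric lives, since its
  moduli are at most \<open>beta c < cmod c\<close>.\<close>

lemma multiplier_lower_bound:
  assumes c: "cmod c > 2" and per: "n \<ge> 1" "(quad c ^^ n) z = z"
  shows "sqrt (cmod c / 2) ^ n \<le> cmod (deriv (quad c ^^ n) z)"
proof -
  let ?R = "cmod c"
  let ?y = "\<lambda>k. (quad c ^^ k) z"
  have lt: "cmod (?y k) < ?R" for k
    using norm_periodic_le_beta[OF per, of k] beta_less_norm[OF c] by simp
  have "sqrt (?R / 2) ^ m * (?R\<^sup>2 - (cmod (?y m))\<^sup>2) \<le> (\<Prod>k<m. 2 * cmod (?y k)) * (?R\<^sup>2 - (cmod z)\<^sup>2)" for m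
  proof (induction m)
    case (Suc m)
    have "sqrt (?R / 2) ^ Suc m * (?R\<^sup>2 - (cmod (?y (Suc m)))\<^sup>2)
       = sqrt (?R / 2) ^ m * (sqrt (?R / 2) * (?R\<^sup>2 - (cmod (quad c (?y m)))\<^sup>2))" by simp
    also have "\<dots> \<le> sqrt (?R / 2) ^ m * (2 * cmod (?y m) * (?R\<^sup>2 - (cmod (?y m))\<^sup>2))"
      using c lt[of m] lt[of "Suc m"] by (intro mult_left_mono quad_expansion_step) auto
    also have "\<dots> = (sqrt (?R / 2) ^ m * (?R\<^sup>2 - (cmod (?y m))\<^sup>2)) * (2 * cmod (?y m))" by simp
    also have "\<dots> \<le> ((\<Prod>k<m. 2 * cmod (?y k)) * (?R\<^sup>2 - (cmod z)\<^sup>2)) * (2 * cmod (?y m))"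
      by (intro mult_right_mono Suc) auto
    finally show ?case by (simp add: mult_ac)
  qed simp
  from this[of n] have "sqrt (?R / 2) ^ n * (?R\<^sup>2 - (cmod z)\<^sup>2) \<le> cmod (deriv (quad c ^^ n) z) * (?R\<^sup>2 - (cmod z)\<^sup>2)"
    by (simp add: per deriv_iterate prod_norm[symmetric] norm_mult)
  moreover have "?R\<^sup>2 - (cmod z)\<^sup>2 > 0"
    using lt[of 0] by (simp add: power_strict_mono)
  ultimately show ?thesis by simp
qed

text \<open>If \<open>cmod c > 2\<close>, then \<open>(cmod c / 2) ^ n\<close> is at most the
  squared modulus of the multiplier, and \<open>beta c < cmod c\<close> transfers this to
  \<open>beta c\<close>. Otherwise \<open>beta c \<le> 2\<close>.\<close>

lemma parameter_bound:
  assumes per: "n \<ge> 1" "(quad c ^^ n) z = z" and \<rho>: "cmod (deriv (quad c ^^ n) z) < exp 1"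
  shows "beta c ^ n \<le> (exp 1)\<^sup>2 * 2 ^ n" "cmod c \<le> 2 * (exp 1)\<^sup>2"
proof -
  have e: "(1::real) \<le> (exp 1)\<^sup>2" by (intro one_le_power) simp
  have "beta c ^ n \<le> (exp 1)\<^sup>2 * 2 ^ n \<and> cmod c \<le> 2 * (exp 1)\<^sup>2"
  proof (cases "cmod c > 2")
    case True
    have "(cmod c / 2) ^ n = (sqrt (cmod c / 2) ^ n)\<^sup>2"
      by (simp add: power_mult[symmetric] mult.commute[of n 2]) (simp add: power_mult)
    also have "\<dots> \<le> (exp 1)\<^sup>2"
      using multiplier_lower_bound[OF True per] \<rho> by (intro power_mono) auto
    finally have *: "(cmod c / 2) ^ n \<le> (exp 1)\<^sup>2" .
    have "cmod c / 2 \<le> (cmod c / 2) ^ n" using True per by (intro self_le_power) auto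
    then have "cmod c \<le> 2 * (exp 1)\<^sup>2" using * by linarith
    moreover have "beta c ^ n \<le> cmod c ^ n"
      using beta_less_norm[OF True] beta_ge_1[of c] by (intro power_mono) auto
    then have "beta c ^ n \<le> (cmod c / 2) ^ n * 2 ^ n" by (simp add: power_divide)
    then have "beta c ^ n \<le> (exp 1)\<^sup>2 * 2 ^ n" 
      by (rule order_trans) (rule mult_right_mono[OF *], simp)
    ultimately show ?thesis by simp
  next
    case False
    have "beta c \<le> 2"
    proof (rule ccontr)
      assume "\<not> beta c \<le> 2"
      then have "beta c * (beta c - 1) > 2 * 1" by (intro mult_strict_mono) auto
      then show False using beta_square[of c] False by (simp add: power2_eq_square algebra_simps)
    qed
    then have "beta c ^ n \<le> 2 ^ n" using beta_ge_1[of c] by (intro power_mono) auto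
    also have "\<dots> \<le> (exp 1)\<^sup>2 * 2 ^ n" using e by simp
    finally show ?thesis using False e by linarith
  qed
  then show "beta c ^ n \<le> (exp 1)\<^sup>2 * 2 ^ n" "cmod c \<le> 2 * (exp 1)\<^sup>2" by auto
qed

section \<open>Maximum modulus on sublevel sets of Green's function\<close>

lemma bounded_green_sublevel: "bounded {z. green c z < a}"
proof (rule boundedI)
  fix z assume "z \<in> {z. green c z < a}"
  then have "beta c * exp (green c z) \<le> beta c * exp a"
    using beta_ge_1[of c] by (intro mult_left_mono) auto
  then show "cmod z \<le> beta c * exp a" using norm_le_beta_green[of z c] by linarith
qed

lemma sublevel_iterate: "{z. green c ((quad c ^^ n) z) < a} = {z. green c z < a / 2 ^ n}"
  by (simp add: green_iterate pos_less_divide_eq mult.commute)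

lemma frontier_sublevel:
  "frontier {z. green c ((quad c ^^ n) z) < a} \<subseteq> {z. green c ((quad c ^^ n) z) = a}"
proof -
  let ?g = "\<lambda>z. green c ((quad c ^^ n) z)"
  have cont: "continuous_on UNIV ?g"
    by (intro continuous_on_compose2[OF continuous_on_green[of UNIV] continuous_on_iterate]) auto
  have "open {z. ?g z < a}" by (intro open_Collect_less cont continuous_intros)
  moreover have "closure {z. ?g z < a} \<subseteq> {z. ?g z \<le> a}"
    by (intro closure_minimal closed_Collect_le cont continuous_intros) auto
  ultimately show ?thesis by (auto simp: frontier_def interior_open)
qed

lemma level_deriv_le:
  assumes "x \<in> {cmod (deriv (quad c ^^ n) z) |z. green c ((quad c ^^ n) z) = a}"
  shows "x \<le> (2 * beta c) ^ n * exp a"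
proof -
  obtain z where z: "x = cmod (deriv (quad c ^^ n) z)" "green c ((quad c ^^ n) z) = a"
    using assms by blast
  have "x \<le> (2 * beta c) ^ n * exp (a - green c z)"
    using norm_deriv_iterate_le[of n c z] z by simp
  also have "\<dots> \<le> (2 * beta c) ^ n * exp a"
    using beta_ge_1[of c] green_nonneg[of c z] by (intro mult_left_mono) auto
  finally show ?thesis .
qed

text \<open>\<open>K_const\<close> sees the derivative on a level set only; the maximum modulus
  principle carries the bound into the bounded sublevel set.\<close>

lemma norm_deriv_iterate_le_Sup:
  assumes "green c ((quad c ^^ n) w) < a"
  shows "cmod (deriv (quad c ^^ n) w) \<le> Sup {cmod (deriv (quad c ^^ n) z) |z. green c ((quad c ^^ n) z) = a}"
    (is "_ \<le> Sup ?D")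
proof (rule maximum_modulus_frontier[of "deriv (quad c ^^ n)" "{z. green c ((quad c ^^ n) z) < a}"])
  have "deriv (quad c ^^ n) = (\<lambda>z. \<Prod>k<n. 2 * (quad c ^^ k) z)" by (rule ext) (rule deriv_iterate)
  moreover have "(\<lambda>z. \<Prod>k<n. 2 * (quad c ^^ k) z) holomorphic_on S" for S
  proof (intro holomorphic_intros)
    show "(quad c ^^ k) holomorphic_on S" for k
      using has_field_derivative_iterate by (meson field_differentiable_def field_differentiable_at_within holomorphic_onI)
  qed
  ultimately have hol: "deriv (quad c ^^ n) holomorphic_on S" for S by simp
  then show "deriv (quad c ^^ n) holomorphic_on (interior {z. green c ((quad c ^^ n) z) < a})" .
  show "continuous_on (closure {z. green c ((quad c ^^ n) z) < a}) (deriv (quad c ^^ n))"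
    by (rule holomorphic_on_imp_continuous_on[OF hol])
  show "bounded {z. green c ((quad c ^^ n) z) < a}"
    unfolding sublevel_iterate by (rule bounded_green_sublevel)
  show "w \<in> {z. green c ((quad c ^^ n) z) < a}" using assms by simp
  fix z assume "z \<in> frontier {z. green c ((quad c ^^ n) z) < a}"
  then have "green c ((quad c ^^ n) z) = a" using frontier_sublevel by blast
  then show "cmod (deriv (quad c ^^ n) z) \<le> Sup ?D"
    by (intro cSup_upper bdd_aboveI[of ?D "(2 * beta c) ^ n * exp a"] level_deriv_le) auto
qed

text \<open>The bound on the supremum needs a nonempty level set. The sublevel set contains
  \<open>w\<close> and is bounded, hence is neither empty nor the plane, and a point of its frontier
  lies on the level.\<close>

lemma Sup_level_deriv_le:
  assumes "green c ((quad c ^^ n) w) < a"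
  shows "Sup {cmod (deriv (quad c ^^ n) z) |z. green c ((quad c ^^ n) z) = a} \<le> (2 * beta c) ^ n * exp a"
proof (rule cSup_least[OF _ level_deriv_le])
  let ?S = "{z. green c ((quad c ^^ n) z) < a}"
  have "bounded ?S" unfolding sublevel_iterate by (rule bounded_green_sublevel)
  have "?S \<noteq> UNIV"
  proof
    assume "?S = UNIV"
    with \<open>bounded ?S\<close> have "bounded (UNIV :: complex set)" by (simp only:)
    then show False by simp
  qed
  moreover have "w \<in> ?S" using assms by (rule CollectI)
  then have "?S \<noteq> {}" by (rule ex_in_conv[THEN iffD1, OF exI])
  ultimately have "frontier ?S \<noteq> {}" unfolding frontier_eq_empty by (simp only: simp_thms)
  then obtain z where "z \<in> frontier ?S" by (auto simp only: ex_in_conv[symmetric])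
  then have "z \<in> {z. green c ((quad c ^^ n) z) = a}" by (rule subsetD[OF frontier_sublevel])
  then have "green c ((quad c ^^ n) z) = a" by (rule CollectD)
  then show "{cmod (deriv (quad c ^^ n) z) |z. green c ((quad c ^^ n) z) = a} \<noteq> {}" by blast
qed

section \<open>Holomorphic continuation of the cycle\<close>

lemma holomorphic_on_iterate_parameter:
  assumes "g holomorphic_on S"
  shows "(\<lambda>w. (quad w ^^ k) (g w)) holomorphic_on S"
proof (induction k)
  case (Suc k)
  then have "(\<lambda>w. ((quad w ^^ k) (g w))\<^sup>2 + w) holomorphic_on S" by (intro holomorphic_intros)
  then show ?case by (simp only: iterate_Suc)
qed (use assms in simp)

lemma continuous_on_iterate_parameter:
  "continuous_on S (\<lambda>p. (quad (fst p) ^^ k) (snd p))"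
proof (induction k)
  case (Suc k)
  then have "continuous_on S (\<lambda>p. ((quad (fst p) ^^ k) (snd p))\<^sup>2 + fst p)" by (intro continuous_intros)
  then show ?case by (simp only: iterate_Suc)
qed (auto intro: continuous_intros)

text \<open>The implicit function is the limit of the simplified Newton iteration
  \<open>y \<mapsto> y + (f\<^sub>w\<^sup>n(y) - y) / (1 - \<rho>)\<close>, which is a uniform contraction for \<open>w\<close> near \<open>c\<close>.\<close>

lemma periodic_continuation_exists:
  assumes per: "(quad c ^^ n) z = z" and \<rho>: "deriv (quad c ^^ n) z \<noteq> 1"
  shows "\<exists>b. periodic_continuation n c z b"
proof -
  define \<rho> where "\<rho> = deriv (quad c ^^ n) z"
  have \<rho>1: "1 - \<rho> \<noteq> 0" using \<rho> by (simp add: \<rho>_def)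
  define \<Phi> where "\<Phi> = (\<lambda>w y. y + ((quad w ^^ n) y - y) / (1 - \<rho>))"
  \<comment> \<open>\<open>\<Psi> w\<close> is the derivative of \<open>\<Phi> w\<close>. It
    vanishes at \<open>(c, z)\<close>, so nearby its modulus is below 1/2.\<close>
  define \<Psi> where "\<Psi> = (\<lambda>w y. 1 + ((\<Prod>k<n. 2 * (quad w ^^ k) y) - 1) / (1 - \<rho>))"
  have der: "(\<Phi> w has_field_derivative \<Psi> w y) (at y within S)" for w y S
    unfolding \<Phi>_def \<Psi>_def
    by (intro DERIV_add DERIV_ident DERIV_cdivide DERIV_diff
        has_field_derivative_at_within[OF has_field_derivative_iterate])
  have "\<Psi> c z = 0" using \<rho>1 by (simp add: \<Psi>_def deriv_iterate[symmetric] \<rho>_def[symmetric] field_simps)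
  moreover have cont: "continuous_on UNIV (\<lambda>p. \<Psi> (fst p) (snd p))"
    unfolding \<Psi>_def using \<rho>1 by (intro continuous_intros continuous_on_iterate_parameter) auto
  ultimately obtain e0 where e0: "e0 > 0" "\<And>p. dist p (c, z) < e0 \<Longrightarrow> dist (\<Psi> (fst p) (snd p)) 0 < 1/2"
    using continuous_on_iff[THEN iffD1, OF cont, THEN bspec, of "(c, z)", THEN spec, of "1/2"] by auto
  define e where "e = e0 / 3"
  have e: "e > 0" using e0 by (simp add: e_def)
  have \<Psi>: "cmod (\<Psi> w y) \<le> 1/2" if "w \<in> ball c e" "y \<in> cball z e" for w y
  proof -
    have "dist (w, y) (c, z) \<le> dist w c + dist y z" by (simp add: dist_Pair_Pair sqrt_sum_squares_le_sum)
    also have "\<dots> < e0" using that e by (auto simp: dist_commute e_def)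
    finally show ?thesis using e0(2)[of "(w, y)"] by simp
  qed
  have contr: "cmod (\<Phi> w y - \<Phi> w y') \<le> 1/2 * cmod (y - y')"
    if "w \<in> ball c e" "y \<in> cball z e" "y' \<in> cball z e" for w y y'
    by (rule field_differentiable_bound[of "cball z e" _ "\<Psi> w"]) (use that der \<Psi> in auto)
  have "\<Phi> c z = z" by (simp add: \<Phi>_def per)
  moreover have cont: "continuous_on UNIV (\<lambda>w. \<Phi> w z)"
    unfolding \<Phi>_def by (intro holomorphic_on_imp_continuous_on holomorphic_intros holomorphic_on_iterate_parameter \<rho>1)
  ultimately obtain d0 where d0: "d0 > 0" "\<And>w. dist w c < d0 \<Longrightarrow> dist (\<Phi> w z) z < e/2"
    using continuous_on_iff[THEN iffD1, OF cont, THEN bspec, of c, THEN spec, of "e/2"] e by auto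
  \<comment> \<open>For these parameters the starting point moves by at most \<open>e/2\<close>; the
    contraction adds at most another \<open>e/2\<close>, so all iterates stay in
    \<open>cball z e\<close>.\<close>
  define d where "d = min d0 e"
  have d: "d > 0" "d \<le> e" "\<And>w. w \<in> ball c d \<Longrightarrow> cmod (\<Phi> w z - z) \<le> e/2"
    using d0 e by (auto simp: d_def dist_norm[symmetric] dist_commute less_imp_le)
  define B where "B = (\<lambda>k w. (\<Phi> w ^^ k) z)"
  have B_Suc: "B (Suc k) w = \<Phi> w (B k w)" and B_0: "B 0 w = z" for k w by (simp_all add: B_def)
  have Bz: "B k w \<in> cball z e" if "w \<in> ball c d" for k w
  proof (induction k)
    case (Suc k)
    have "cmod (B (Suc k) w - z) \<le> cmod (\<Phi> w (B k w) - \<Phi> w z) + cmod (\<Phi> w z - z)"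
      using norm_triangle_ineq[of "\<Phi> w (B k w) - \<Phi> w z" "\<Phi> w z - z"] by (simp add: B_Suc)
    also have "cmod (\<Phi> w (B k w) - \<Phi> w z) \<le> 1/2 * cmod (B k w - z)"
      using that d Suc e by (intro contr) auto
    also have "\<dots> \<le> 1/2 * e" using Suc by (simp add: dist_norm norm_minus_commute)
    also have "cmod (\<Phi> w z - z) \<le> e/2" using d that by blast
    finally show ?case by (simp add: dist_norm norm_minus_commute)
  qed (use e in \<open>simp add: B_0\<close>)
  have Bdiff: "cmod (B (Suc k) w - B k w) \<le> e * (1/2) ^ k" if "w \<in> ball c d" for k w
  proof (induction k)
    case 0
    then show ?case using d(3)[OF that] e by (simp add: B_Suc B_0)
  next
    case (Suc k)
    have "cmod (B (Suc (Suc k)) w - B (Suc k) w) = cmod (\<Phi> w (B (Suc k) w) - \<Phi> w (B k w))"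
      by (simp only: B_Suc)
    also have "\<dots> \<le> 1/2 * cmod (B (Suc k) w - B k w)"
      using that d by (intro contr Bz) auto
    finally show ?case using Suc by simp
  qed
  \<comment> \<open>The limit of the iterates is written as a telescoping series with a geometric
    majorant, so that convergence is uniform and the limit holomorphic.\<close>
  define b where "b = (\<lambda>w. z + (\<Sum>k. B (Suc k) w - B k w))"
  have "uniform_limit (ball c d) (\<lambda>m w. \<Sum>k<m. B (Suc k) w - B k w) (\<lambda>w. \<Sum>k. B (Suc k) w - B k w) sequentially"
    by (rule Weierstrass_m_test[OF Bdiff]) (auto intro!: summable_mult summable_geometric)
  then have "uniform_limit (ball c d) (\<lambda>m w. z + (\<Sum>k<m. B (Suc k) w - B k w)) b sequentially"
    unfolding b_def by (intro uniform_limit_add uniform_limit_const)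
  moreover have "z + (\<Sum>k<m. B (Suc k) w - B k w) = B m w" for m w
    by (simp add: sum_lessThan_telescope[of "\<lambda>k. B k w"] B_0)
  ultimately have ul: "uniform_limit (ball c d) B b sequentially" by simp
  have holB: "B k holomorphic_on S" for k S
  proof (induction k)
    case (Suc k)
    then show ?case unfolding B_Suc[abs_def] \<Phi>_def
      by (intro holomorphic_intros holomorphic_on_iterate_parameter \<rho>1)
  qed (simp add: B_0[abs_def])
  have holb: "b holomorphic_on ball c d"
  proof (rule holomorphic_uniform_sequence[OF open_ball holB])
    fix x assume "x \<in> ball c d"
    then obtain r where "r > 0" "cball x r \<subseteq> ball c d" using open_contains_cball open_ball by metis
    then show "\<exists>r>0. cball x r \<subseteq> ball c d \<and> uniform_limit (cball x r) B b sequentially"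
      using uniform_limit_on_subset[OF ul] by blast
  qed
  have lim: "(\<lambda>k. B k w) \<longlonglongrightarrow> b w" if "w \<in> ball c d" for w
    by (rule tendsto_uniform_limitI[OF ul that])
  have fix': "(quad w ^^ n) (b w) = b w" if "w \<in> ball c d" for w
  proof -
    have "isCont (\<Phi> w) (b w)" using der DERIV_isCont by blast
    then have "(\<lambda>k. \<Phi> w (B k w)) \<longlonglongrightarrow> \<Phi> w (b w)"
      using lim[OF that] by (rule isCont_tendsto_compose)
    moreover have "(\<lambda>k. \<Phi> w (B k w)) \<longlonglongrightarrow> b w"
      using LIMSEQ_Suc[OF lim[OF that]] by (simp add: B_Suc)
    ultimately have "\<Phi> w (b w) = b w" using LIMSEQ_unique by blast
    then show ?thesis using \<rho>1 by (simp add: \<Phi>_def)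
  qed
  have "B k c = z" for k by (induction k) (simp_all add: B_0 B_Suc \<open>\<Phi> c z = z\<close>)
  then have "b c = z" by (simp add: b_def)
  then have "periodic_continuation n c z b"
    unfolding periodic_continuation_def using holb fix' d(1) by (intro conjI exI[of _ "ball c d"]) auto
  then show ?thesis by (rule exI[of "periodic_continuation n c z" b])
qed

text \<open>\<open>d k\<close> is the parameter derivative of the \<open>k\<close>-th point of the
  continued orbit. Its recursion differentiates one step of the map, and the last identity is the
  logarithmic derivative of the product formula for the multiplier.\<close>

lemma multiplier_deriv_eq:
  assumes per: "(quad c ^^ n) z = z" and \<rho>: "multiplier n c z \<noteq> 1" "multiplier n c z \<noteq> 0"
  obtains d where "\<And>k. d (Suc k) = 2 * (quad c ^^ k) z * d k + 1" "d n = d 0"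
    "multiplier_deriv n c z = multiplier n c z * (\<Sum>k<n. d k / (quad c ^^ k) z)"
proof -
  define b where "b = continued_point n c z"
  have "\<exists>b. periodic_continuation n c z b"
    using \<rho>(1) by (intro periodic_continuation_exists[OF per]) (simp add: multiplier_def)
  from someI_ex[OF this] have "periodic_continuation n c z b"
    by (simp only: b_def continued_point_def)
  then obtain U where U: "open U" "c \<in> U" "b holomorphic_on U" "\<And>w. w \<in> U \<Longrightarrow> (quad w ^^ n) (b w) = b w"
    and bc: "b c = z" unfolding periodic_continuation_def by blast
  define g where "g = (\<lambda>k w. (quad w ^^ k) (b w))"
  define d where "d = (\<lambda>k. deriv (g k) c)"
  have gd: "(g k has_field_derivative d k) (at c)" for k
    unfolding d_def using U holomorphic_on_iterate_parameter[OF U(3), of k]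
    by (intro holomorphic_derivI[of _ U]) (auto simp: g_def)
  have gc: "g k c = (quad c ^^ k) z" for k by (simp add: g_def bc)
  have "d (Suc k) = 2 * (quad c ^^ k) z * d k + 1" for k
  proof -
    have "((\<lambda>w. (g k w)\<^sup>2 + w) has_field_derivative 2 * g k c * d k + 1) (at c)"
      by (rule derivative_eq_intros gd refl)+ simp
    moreover have "(\<lambda>w. (g k w)\<^sup>2 + w) = g (Suc k)" unfolding g_def iterate_Suc ..
    ultimately show ?thesis using gd[of "Suc k"] DERIV_unique gc by metis
  qed
  moreover have "d n = d 0"
  proof -
    have "\<forall>\<^sub>F w in nhds c. g n w = g 0 w"
      using U by (auto simp: eventually_nhds g_def)
    then show ?thesis unfolding d_def by (intro deriv_cong_ev) auto
  qed
  moreover have "multiplier_deriv n c z = multiplier n c z * (\<Sum>k<n. d k / (quad c ^^ k) z)"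
  proof -
    have nz: "g k c \<noteq> 0" if "k < n" for k
      using \<rho>(2) that by (auto simp: multiplier_def deriv_iterate gc)
    have "((\<lambda>w. \<Prod>k<m. 2 * g k w) has_field_derivative (\<Prod>k<m. 2 * g k c) * (\<Sum>k<m. d k / g k c)) (at c)"
      if "m \<le> n" for m
      using that
    proof (induction m)
      case (Suc m)
      then have der: "((\<lambda>w. (\<Prod>k<m. 2 * g k w) * (2 * g m w)) has_field_derivative 
          ((\<Prod>k<m. 2 * g k c) * (\<Sum>k<m. d k / g k c)) * (2 * g m c) + (2 * d m) * (\<Prod>k<m. 2 * g k c)) (at c)"
        by (intro DERIV_mult DERIV_cmult gd) auto
      have "g m c \<noteq> 0" using nz Suc by auto
      then have "((\<Prod>k<m. 2 * g k c) * (\<Sum>k<m. d k / g k c)) * (2 * g m c) + (2 * d m) * (\<Prod>k<m. 2 * g k c)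
        = (\<Prod>k<Suc m. 2 * g k c) * (\<Sum>k<Suc m. d k / g k c)"
        by (simp add: field_simps)
      then show ?case using der by (simp only: prod.lessThan_Suc)
    qed auto
    from this[of n] have "((\<lambda>w. multiplier n w (b w)) has_field_derivative 
        multiplier n c z * (\<Sum>k<n. d k / (quad c ^^ k) z)) (at c)"
      by (simp add: multiplier_def deriv_iterate g_def bc)
    then show ?thesis unfolding multiplier_deriv_def b_def[symmetric] by (rule DERIV_imp_deriv)
  qed
  ultimately show ?thesis by (rule that)
qed

section \<open>Polar sums along the cycle\<close>

text \<open>Pushing forward a polar part at \<open>b k\<close> leaves this residue at the next
  point, see \<open>polar_quadratic_pushforward\<close>. The start \<open>x\<close> is free until
  periodicity fixes it.\<close>

primrec residue_seq :: "(nat \<Rightarrow> complex) \<Rightarrow> complex \<Rightarrow> nat \<Rightarrow> complex" where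
  "residue_seq b x 0 = x"
| "residue_seq b x (Suc k) = residue_seq b x k / (2 * b k) - 1 / (2 * (b k)\<^sup>2)"

lemma residue_seq_affine:
  fixes b :: "nat \<Rightarrow> complex"
  assumes "\<And>k. k < m \<Longrightarrow> b k \<noteq> 0"
  shows "residue_seq b x m * (\<Prod>k<m. 2 * b k) = x + residue_seq b 0 m * (\<Prod>k<m. 2 * b k)"
  using assms
proof (induction m)
  case (Suc m)
  have [simp]: "b m \<noteq> 0" using Suc.prems by simp
  have *: "residue_seq b y (Suc m) * (\<Prod>k<Suc m. 2 * b k) 
      = residue_seq b y m * (\<Prod>k<m. 2 * b k) - (\<Prod>k<m. 2 * b k) / b m" for y
    by (simp add: field_simps power2_eq_square)
  show ?case unfolding * using Suc by simp
qed simp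

text \<open>After one turn the residue depends affinely on the start \<open>x\<close>, with slope
  \<open>1 / P\<close> for the multiplier \<open>P\<close>. As \<open>P \<noteq> 1\<close>, this
  affine map has a fixed point.\<close>

lemma periodic_residues_exist:
  fixes b :: "nat \<Rightarrow> complex"
  assumes "\<And>k. k < n \<Longrightarrow> b k \<noteq> 0" "(\<Prod>k<n. 2 * b k) \<noteq> 1"
  obtains r where "\<And>k. r (Suc k) = r k / (2 * b k) - 1 / (2 * (b k)\<^sup>2)" "r n = r 0"
proof -
  define P where "P = (\<Prod>k<n. 2 * b k)"
  define x where "x = residue_seq b 0 n * P / (P - 1)"
  have P: "P \<noteq> 1" "P \<noteq> 0" using assms by (auto simp: P_def)
  have "residue_seq b x n * P = x + residue_seq b 0 n * P"
    unfolding P_def by (rule residue_seq_affine) (use assms in auto)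
  also have "\<dots> = x * P" using P by (simp add: x_def field_simps)
  finally have "residue_seq b x n = residue_seq b x 0" using P by simp
  then show ?thesis by (intro that[of "residue_seq b x"]) auto
qed

lemma sum_shift_periodic:
  fixes h :: "nat \<Rightarrow> 'a::ab_group_add"
  assumes "h n = h 0"
  shows "(\<Sum>k<n. h (Suc k)) = (\<Sum>k<n. h k)"
  using sum_lessThan_telescope[of h n] assms by (simp add: sum_subtractf)

text \<open>The recursions for \<open>r\<close> and \<open>d\<close> are adjoint to each other.\<close>

lemma sum_residues_eq:
  fixes b r d :: "nat \<Rightarrow> complex"
  assumes b: "\<And>k. k < n \<Longrightarrow> b k \<noteq> 0"
    and r: "\<And>k. r (Suc k) = r k / (2 * b k) - 1 / (2 * (b k)\<^sup>2)" "r n = r 0"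
    and d: "\<And>k. d (Suc k) = 2 * b k * d k + 1" "d n = d 0"
  shows "(\<Sum>k<n. r k) = (\<Sum>k<n. d k / b k)"
proof -
  \<comment> \<open>Each residue is an increment of \<open>r k * d k\<close>, which sums to 0 around
    the cycle, plus \<open>d k / b k\<close>.\<close>
  have "(\<Sum>k<n. r (Suc k)) = (\<Sum>k<n. r (Suc k) * d (Suc k) - (r k * d k - d k / b k))"
  proof (rule sum.cong)
    fix k assume "k \<in> {..<n}"
    then have [simp]: "b k \<noteq> 0" using b by simp
    have "r (Suc k) * (2 * b k) = r k - 1 / b k" by (simp add: r(1) field_simps power2_eq_square)
    then have "r (Suc k) * (2 * b k) * d k = (r k - 1 / b k) * d k" by (simp only:)
    moreover have "r (Suc k) * d (Suc k) = r (Suc k) * (2 * b k) * d k + r (Suc k)"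
      by (simp add: d(1) algebra_simps)
    ultimately have "r (Suc k) * d (Suc k) = (r k - 1 / b k) * d k + r (Suc k)" by (simp only:)
    then show "r (Suc k) = r (Suc k) * d (Suc k) - (r k * d k - d k / b k)"
      by (simp add: algebra_simps)
  qed simp
  also have "\<dots> = (\<Sum>k<n. r (Suc k) * d (Suc k)) - (\<Sum>k<n. r k * d k) + (\<Sum>k<n. d k / b k)"
    by (simp add: sum_subtractf)
  also have "(\<Sum>k<n. r (Suc k) * d (Suc k)) = (\<Sum>k<n. r k * d k)"
    by (rule sum_shift_periodic[of "\<lambda>k. r k * d k"]) (simp add: r d)
  finally show ?thesis using sum_shift_periodic[of r n] r by simp
qed

text \<open>Multiplying the recursion by \<open>2 * (b k)^2 = 2 * (b (Suc k) - c)\<close> gives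
  \<open>2 * r (Suc k) * (b (Suc k) - c) = r k * b k - 1\<close>, which is summed around the
  cycle.\<close>

lemma sum_residues_moment:
  fixes b r :: "nat \<Rightarrow> complex"
  assumes b: "\<And>k. k < n \<Longrightarrow> b k \<noteq> 0" "\<And>k. b (Suc k) = (b k)\<^sup>2 + c" "b n = b 0"
    and r: "\<And>k. r (Suc k) = r k / (2 * b k) - 1 / (2 * (b k)\<^sup>2)" "r n = r 0"
  shows "2 * c * (\<Sum>k<n. r k) = of_nat n + (\<Sum>k<n. r k * b k)"
proof -
  have "(\<Sum>k<n. 2 * (r (Suc k) * b (Suc k)) - 2 * c * r (Suc k)) = (\<Sum>k<n. r k * b k - 1)"
  proof (rule sum.cong)
    fix k assume "k \<in> {..<n}"
    then have [simp]: "b k \<noteq> 0" using b by simp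
    have "r (Suc k) * (2 * (b k)\<^sup>2) = r k * b k - 1" by (simp add: r(1) field_simps power2_eq_square)
    then show "2 * (r (Suc k) * b (Suc k)) - 2 * c * r (Suc k) = r k * b k - 1"
      by (simp add: b(2) algebra_simps)
  qed simp
  then have "2 * (\<Sum>k<n. r (Suc k) * b (Suc k)) - 2 * c * (\<Sum>k<n. r (Suc k)) = (\<Sum>k<n. r k * b k) - of_nat n"
    by (simp add: sum_subtractf sum_distrib_left)
  moreover have "(\<Sum>k<n. r (Suc k) * b (Suc k)) = (\<Sum>k<n. r k * b k)"
    by (rule sum_shift_periodic[of "\<lambda>k. r k * b k"]) (simp add: r b)
  moreover have "(\<Sum>k<n. r (Suc k)) = (\<Sum>k<n. r k)" by (rule sum_shift_periodic) (rule r)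
  ultimately show ?thesis by (simp add: algebra_simps)
qed

section \<open>Polar sums and their push-forwards\<close>

definition polar_sum ::
    "nat \<Rightarrow> (nat \<Rightarrow> complex) \<Rightarrow> (nat \<Rightarrow> complex) \<Rightarrow> (nat \<Rightarrow> complex) \<Rightarrow> complex \<Rightarrow> complex" where
  "polar_sum n m r p x = (\<Sum>k<n. m k / (x - p k)\<^sup>2 + r k / (x - p k))"

text \<open>Sum over the preimages \<open>q\<close> and \<open>- q\<close>, divided by the squared
  derivative. The double pole at \<open>b\<close> moves to the image of \<open>b\<close> with
  coefficient 1, the residue changes as in \<open>residue_seq\<close>, and the critical point leaves
  a simple pole \<open>1 / q^2\<close> at the critical value.\<close>

lemma polar_quadratic_pushforward:
  fixes q b r :: complex
  assumes "q \<noteq> 0" "b \<noteq> 0" "q \<noteq> b" "q \<noteq> - b"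
  shows "((1 / (q - b)\<^sup>2 + r / (q - b)) + (1 / (- q - b)\<^sup>2 + r / (- q - b))) / (4 * q\<^sup>2)
    = 1 / (q\<^sup>2 - b\<^sup>2)\<^sup>2 + (r / (2 * b) - 1 / (2 * b\<^sup>2)) * (1 / (q\<^sup>2 - b\<^sup>2) - 1 / q\<^sup>2)"
proof -
  define D where "D = q\<^sup>2 - b\<^sup>2"
  have ne: "q - b \<noteq> 0" "q + b \<noteq> 0" "- q - b \<noteq> 0" using assms by (auto simp: add_eq_0_iff)
  have D1: "D = (q - b) * (q + b)" by (simp add: D_def power2_eq_square algebra_simps)
  then have D: "D = (q - b) * (q + b)" "D \<noteq> 0" using ne by auto
  have 1: "1 / (q - b) + 1 / (- q - b) = 2 * b / D"
    using ne unfolding D(1) by (simp add: divide_simps) (simp add: algebra_simps)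
  have 2: "1 / (q - b)\<^sup>2 + 1 / (- q - b)\<^sup>2 = 2 * (q\<^sup>2 + b\<^sup>2) / D\<^sup>2"
  proof -
    have "(- q - b)\<^sup>2 = (q + b)\<^sup>2" by (simp add: power2_eq_square algebra_simps)
    then show ?thesis using ne unfolding D(1) power_mult_distrib
      by (simp add: divide_simps) (simp add: power2_eq_square algebra_simps)
  qed
  have "((1 / (q - b)\<^sup>2 + r / (q - b)) + (1 / (- q - b)\<^sup>2 + r / (- q - b))) 
     = (1 / (q - b)\<^sup>2 + 1 / (- q - b)\<^sup>2) + r * (1 / (q - b) + 1 / (- q - b))"
    by (simp add: algebra_simps)
  then have "((1 / (q - b)\<^sup>2 + r / (q - b)) + (1 / (- q - b)\<^sup>2 + r / (- q - b))) / (4 * q\<^sup>2)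
     = (2 * (q\<^sup>2 + b\<^sup>2) / D\<^sup>2 + r * (2 * b / D)) / (4 * q\<^sup>2)"
    unfolding 1 2 by simp
  also have "\<dots> = 1 / D\<^sup>2 + (r / (2 * b) - 1 / (2 * b\<^sup>2)) * (1 / D - 1 / q\<^sup>2)"
  proof -
    have "(1 / D - 1 / q\<^sup>2) = b\<^sup>2 / (D * q\<^sup>2)"
      using assms D(2) by (simp add: divide_simps) (simp add: D_def)
    moreover have "(r / (2 * b) - 1 / (2 * b\<^sup>2)) * (b\<^sup>2 / (D * q\<^sup>2)) = (r * b - 1) / (2 * D * q\<^sup>2)"
      using assms D(2) by (simp add: divide_simps power2_eq_square)
    moreover have "(2 * (q\<^sup>2 + b\<^sup>2) / D\<^sup>2 + r * (2 * b / D)) / (4 * q\<^sup>2) = 1 / D\<^sup>2 + (r * b - 1) / (2 * D * q\<^sup>2)"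
    proof -
      have "q\<^sup>2 + b\<^sup>2 = 2 * q\<^sup>2 - D" by (simp add: D_def)
      then show ?thesis using assms D(2)
        by (simp add: divide_simps) (simp add: power2_eq_square algebra_simps)
    qed
    ultimately show ?thesis by simp
  qed
  finally show ?thesis by (simp add: D_def)
qed

text \<open>With weight one over the derivative the two preimages enter with opposite signs. The
  residue is kept, the double-pole coefficient is multiplied by the derivative \<open>2 * b\<close>,
  and the critical value acquires no pole.\<close>

lemma polar_vector_pushforward:
  fixes q b m r :: complex
  assumes "q \<noteq> 0" "q \<noteq> b" "q \<noteq> - b"
  shows "((m / (q - b)\<^sup>2 + r / (q - b)) - (m / (- q - b)\<^sup>2 + r / (- q - b))) / (2 * q)
    = 2 * b * m / (q\<^sup>2 - b\<^sup>2)\<^sup>2 + r / (q\<^sup>2 - b\<^sup>2)"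
proof -
  define D where "D = q\<^sup>2 - b\<^sup>2"
  have ne: "q - b \<noteq> 0" "q + b \<noteq> 0" "- q - b \<noteq> 0" using assms by (auto simp: add_eq_0_iff)
  have D1: "D = (q - b) * (q + b)" by (simp add: D_def power2_eq_square algebra_simps)
  then have D: "D = (q - b) * (q + b)" "D \<noteq> 0" using ne by auto
  have 1: "1 / (q - b) - 1 / (- q - b) = 2 * q / D"
    using ne unfolding D(1) by (simp add: divide_simps) (simp add: algebra_simps)
  have 2: "1 / (q - b)\<^sup>2 - 1 / (- q - b)\<^sup>2 = 4 * q * b / D\<^sup>2"
  proof -
    have "(- q - b)\<^sup>2 = (q + b)\<^sup>2" by (simp add: power2_eq_square algebra_simps)
    then show ?thesis using ne unfolding D(1) power_mult_distrib
      by (simp add: divide_simps) (simp add: power2_eq_square algebra_simps)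
  qed
  have "((m / (q - b)\<^sup>2 + r / (q - b)) - (m / (- q - b)\<^sup>2 + r / (- q - b))) 
     = m * (1 / (q - b)\<^sup>2 - 1 / (- q - b)\<^sup>2) + r * (1 / (q - b) - 1 / (- q - b))"
    by (simp add: algebra_simps)
  also have "\<dots> / (2 * q) = 2 * b * m / D\<^sup>2 + r / D"
    unfolding 1 2 using assms D(2) by (simp add: divide_simps) (simp add: power2_eq_square algebra_simps)
  finally show ?thesis by (simp add: D_def)
qed

text \<open>The map permutes the poles of the cycle together with their residues, so the sum
  reproduces itself up to the simple poles collected at \<open>c\<close>.\<close>

lemma polar_sum_quadratic_pushforward:
  assumes b: "\<And>k. k < n \<Longrightarrow> b k \<noteq> 0" "\<And>k. b (Suc k) = (b k)\<^sup>2 + c" "b n = b 0"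
    and r: "\<And>k. r (Suc k) = r k / (2 * b k) - 1 / (2 * (b k)\<^sup>2)" "r n = r 0"
    and x: "x = q\<^sup>2 + c" "q \<noteq> 0" "\<And>k. x \<noteq> b k"
  shows "polar_sum n (\<lambda>_. 1) r b x = (polar_sum n (\<lambda>_. 1) r b q + polar_sum n (\<lambda>_. 1) r b (- q)) / (4 * q\<^sup>2)
     + (\<Sum>k<n. r k) / (x - c)"
proof -
  have "(polar_sum n (\<lambda>_. 1) r b q + polar_sum n (\<lambda>_. 1) r b (- q)) / (4 * q\<^sup>2)
     = (\<Sum>k<n. 1 / (x - b (Suc k))\<^sup>2 + r (Suc k) / (x - b (Suc k)) - r (Suc k) / (x - c))"
    unfolding polar_sum_def sum.distrib[symmetric] sum_divide_distrib
  proof (rule sum.cong)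
    fix k assume "k \<in> {..<n}"
    then have "b k \<noteq> 0" using b by simp
    moreover have "q \<noteq> b k" "q \<noteq> - b k" using x(1) x(3)[of "Suc k"] b(2)[of k] by auto
    ultimately have "((1 / (q - b k)\<^sup>2 + r k / (q - b k)) + (1 / (- q - b k)\<^sup>2 + r k / (- q - b k))) / (4 * q\<^sup>2)
      = 1 / (q\<^sup>2 - (b k)\<^sup>2)\<^sup>2 + r (Suc k) * (1 / (q\<^sup>2 - (b k)\<^sup>2) - 1 / q\<^sup>2)"
      unfolding r(1) using x(2) by (intro polar_quadratic_pushforward)
    also have "q\<^sup>2 - (b k)\<^sup>2 = x - b (Suc k)" by (simp add: x(1) b(2))
    also have "q\<^sup>2 = x - c" by (simp add: x(1))
    finally show "(1 / (q - b k)\<^sup>2 + r k / (q - b k) + (1 / (- q - b k)\<^sup>2 + r k / (- q - b k))) / (4 * q\<^sup>2)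
      = 1 / (x - b (Suc k))\<^sup>2 + r (Suc k) / (x - b (Suc k)) - r (Suc k) / (x - c)"
      by (simp add: algebra_simps x(1))
  qed simp
  also have "\<dots> = (\<Sum>k<n. 1 / (x - b k)\<^sup>2 + r k / (x - b k) - r k / (x - c))"
    by (rule sum_shift_periodic[of "\<lambda>k. 1 / (x - b k)\<^sup>2 + r k / (x - b k) - r k / (x - c)"]) (simp add: r b)
  also have "\<dots> = polar_sum n (\<lambda>_. 1) r b x - (\<Sum>k<n. r k) / (x - c)"
    by (simp add: polar_sum_def sum_subtractf sum_divide_distrib)
  finally show ?thesis by simp
qed

lemma polar_sum_vector_pushforward:
  assumes "q \<noteq> 0" "x = q\<^sup>2 + c" "\<And>k. k < n \<Longrightarrow> x \<noteq> (p k)\<^sup>2 + c"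
  shows "polar_sum n (\<lambda>k. 2 * p k * m k) r (\<lambda>k. (p k)\<^sup>2 + c) x
     = (polar_sum n m r p q - polar_sum n m r p (- q)) / (2 * q)"
  unfolding polar_sum_def sum_subtractf[symmetric] sum_divide_distrib
proof (rule sum.cong)
  fix k assume "k \<in> {..<n}"
  then have "q \<noteq> p k" "q \<noteq> - p k" using assms(2) assms(3)[of k] by auto
  from polar_vector_pushforward[OF assms(1) this, of "m k" "r k"]
  show "2 * p k * m k / (x - ((p k)\<^sup>2 + c))\<^sup>2 + r k / (x - ((p k)\<^sup>2 + c)) =
    (m k / (q - p k)\<^sup>2 + r k / (q - p k) - (m k / (- q - p k)\<^sup>2 + r k / (- q - p k))) / (2 * q)"
    by (simp add: assms(2))
qed simp

section \<open>The integral inequality\<close>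

lemma borel_measurable_green [measurable]: "green c \<in> borel_measurable borel"
  by (rule borel_measurable_continuous_onI[OF continuous_on_green])

lemma borel_measurable_iterate [measurable]: "(quad c ^^ k) \<in> borel_measurable borel"
  by (rule borel_measurable_continuous_onI[OF continuous_on_iterate])

lemma borel_measurable_deriv_iterate [measurable]: "deriv (quad c ^^ k) \<in> borel_measurable borel"
  unfolding deriv_iterate[abs_def] by measurable

lemma borel_measurable_polar_sum [measurable]: "polar_sum n m r p \<in> borel_measurable borel"
  unfolding polar_sum_def[abs_def] by measurable

definition green_shell :: "complex \<Rightarrow> real \<Rightarrow> complex set" where
  "green_shell c s = {x. 0 < green c x \<and> green c x < s}"

lemma sets_green_shell [measurable]: "green_shell c s \<in> sets borel"
  unfolding green_shell_def by measurable

lemma emeasure_green_shell: "emeasure lborel (green_shell c s) = ennreal (area (green_shell c s))"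
proof -
  have "bounded (green_shell c s)"
    by (rule bounded_subset[OF bounded_green_sublevel[of c s]]) (auto simp: green_shell_def)
  then have "emeasure lborel (green_shell c s) < \<infinity>" by (rule emeasure_bounded_finite)
  then show ?thesis by (simp add: area_def emeasure_eq_ennreal_measure less_top)
qed

section \<open>First moments of polar sums\<close>

text \<open>The contour integral of \<open>u * polar_sum n m r p u\<close> is computed by Cauchy's
  formulas for the identity function and its derivative; the pole \<open>p k\<close> contributes
  \<open>m k + r k * p k\<close>.\<close>

lemma polar_sum_circle_bound:
  assumes "\<And>k. k < n \<Longrightarrow> cmod (p k) < R" "R > 0"
  shows "ennreal (2 * pi * cmod (\<Sum>k<n. m k + r k * p k))
    \<le> (\<integral>\<^sup>+t. indicator {0<..<1} t * ennreal (2 * pi * R\<^sup>2 * cmod (polar_sum n m r p (of_real R * exp (2 * of_real pi * \<i> * of_real t)))) \<partial>lborel)"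
proof -
  let ?\<Lambda> = "\<Sum>k<n. m k + r k * p k"
  let ?Q = "polar_sum n m r p"
  let ?w = "\<lambda>t::real. of_real R * exp (2 * of_real pi * \<i> * of_real t) :: complex"
  have ci: "((\<lambda>u. u * (m k / (u - p k)\<^sup>2 + r k / (u - p k))) has_contour_integral 2 * pi * \<i> * (m k + r k * p k)) (circlepath 0 R)"
    if "k < n" for k
  proof -
    have pk: "p k \<in> ball 0 R" using assms(1)[OF that] by simp
    have "((\<lambda>u. u / (u - p k)) has_contour_integral 2 * pi * \<i> * p k) (circlepath 0 R)"
      using Cauchy_integral_circlepath_simple[of "\<lambda>u. u" 0 R "p k"] pk by (simp add: holomorphic_intros)
    moreover have "((\<lambda>u. u / (u - p k)\<^sup>2) has_contour_integral 2 * pi * \<i>) (circlepath 0 R)"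
      using Cauchy_has_contour_integral_higher_derivative_circlepath[of 0 R "\<lambda>u. u" "p k" 1] pk
      by (simp add: power2_eq_square continuous_intros holomorphic_intros)
    ultimately have "((\<lambda>u. m k * (u / (u - p k)\<^sup>2) + r k * (u / (u - p k))) has_contour_integral 
        m k * (2 * pi * \<i>) + r k * (2 * pi * \<i> * p k)) (circlepath 0 R)"
      by (intro has_contour_integral_add has_contour_integral_lmul)
    then show ?thesis by (simp add: algebra_simps)
  qed
  have "((\<lambda>u. \<Sum>k<n. u * (m k / (u - p k)\<^sup>2 + r k / (u - p k))) has_contour_integral (\<Sum>k<n. 2 * pi * \<i> * (m k + r k * p k))) (circlepath 0 R)"
    using ci by (intro has_contour_integral_sum) auto
  then have "((\<lambda>u. u * ?Q u) has_contour_integral 2 * pi * \<i> * ?\<Lambda>) (circlepath 0 R)"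
    by (simp only: polar_sum_def sum_distrib_left)
  then have "((\<lambda>t. circlepath 0 R t * ?Q (circlepath 0 R t) * vector_derivative (circlepath 0 R) (at t within {0..1}))
      has_integral 2 * pi * \<i> * ?\<Lambda>) {0..1}"
    by (simp add: has_contour_integral_def)
  then have hi: "((\<lambda>t. ?w t * ?Q (?w t) * (2 * pi * \<i> * ?w t)) has_integral 2 * pi * \<i> * ?\<Lambda>) {0..1}"
  proof (rule has_integral_eq[rotated])
    fix t :: real assume "t \<in> {0..1}"
    then have vd: "vector_derivative (circlepath 0 R) (at t within {0..1}) = 2 * pi * \<i> * R * exp (2 * of_real pi * \<i> * t)"
      by (intro vector_derivative_circlepath01) auto
    have cp: "circlepath 0 R t = ?w t" by (simp add: circlepath)
    show "circlepath 0 R t * ?Q (circlepath 0 R t) * vector_derivative (circlepath 0 R) (at t within {0..1})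
        = ?w t * ?Q (?w t) * (2 * pi * \<i> * ?w t)"
      unfolding vd cp by simp
  qed
  have w: "cmod (?w t) = R" for t using assms(2) by (simp add: norm_mult norm_exp_eq_Re)
  have "?w t \<noteq> p k" if "k < n" for t k using w[of t] assms(1)[OF that] by auto
  then have cont: "continuous_on {0..1} (\<lambda>t. cmod (?w t * ?Q (?w t) * (2 * pi * \<i> * ?w t)))"
    unfolding polar_sum_def by (intro continuous_intros) auto
  have "cmod (integral {0..1} (\<lambda>t. ?w t * ?Q (?w t) * (2 * pi * \<i> * ?w t)))
     \<le> integral {0..1} (\<lambda>t. cmod (?w t * ?Q (?w t) * (2 * pi * \<i> * ?w t)))"
    by (rule integral_norm_bound_integral) (use hi cont in \<open>auto intro: integrable_continuous_interval\<close>)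
  then have "2 * pi * cmod ?\<Lambda> \<le> integral {0..1} (\<lambda>t. cmod (?w t * ?Q (?w t) * (2 * pi * \<i> * ?w t)))"
    unfolding integral_unique[OF hi] by (simp add: norm_mult)
  then have "ennreal (2 * pi * cmod ?\<Lambda>) \<le> ennreal (integral {0..1} (\<lambda>t. cmod (?w t * ?Q (?w t) * (2 * pi * \<i> * ?w t))))"
    by (rule ennreal_leI)
  also have "\<dots> = (\<integral>\<^sup>+t. ennreal (indicator {0..1} t * cmod (?w t * ?Q (?w t) * (2 * pi * \<i> * ?w t))) \<partial>lborel)"
    by (rule nn_integral_has_integral_lebesgue[symmetric])
      (use cont in \<open>auto intro: integrable_integral integrable_continuous_interval\<close>)
  also have "\<dots> = (\<integral>\<^sup>+t. indicator {0<..<1} t * ennreal (2 * pi * R\<^sup>2 * cmod (?Q (?w t))) \<partial>lborel)"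
  proof (rule nn_integral_cong_AE)
    have "AE t in lborel. t \<noteq> (0::real)" "AE t in lborel. t \<noteq> (1::real)"
      by (rule AE_lborel_singleton)+
    then show "AE t in lborel. ennreal (indicator {0..1} t * cmod (?w t * ?Q (?w t) * (2 * pi * \<i> * ?w t)))
        = indicator {0<..<1} t * ennreal (2 * pi * R\<^sup>2 * cmod (?Q (?w t)))"
    proof eventually_elim
      case (elim t)
      have "cmod (?w t * ?Q (?w t) * (2 * pi * \<i> * ?w t)) = 2 * pi * R\<^sup>2 * cmod (?Q (?w t))"
        unfolding norm_mult[of "_ * _" "_ * _"] norm_mult[of "?w t" "?Q _"] norm_mult[of _ "?w t"] w
        by (simp add: norm_mult power2_eq_square)
      then show ?case using elim by (auto simp: indicator_def)
    qed
  qed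
  finally show ?thesis .
qed

text \<open>All circles with radius between \<open>R1\<close> and \<open>R2\<close> enclose the same
  poles and give the same moment. Integrating over the logarithm of the radius produces the factor
  \<open>ln R2 - ln R1\<close>.\<close>

lemma polar_sum_annulus_bound:
  assumes p: "\<And>k. k < n \<Longrightarrow> cmod (p k) \<le> R1" and R: "0 < R1" "R1 < R2"
  shows "ennreal (2 * pi * (ln R2 - ln R1) * cmod (\<Sum>k<n. m k + r k * p k))
    \<le> (\<integral>\<^sup>+x. indicator {x. R1 < cmod x \<and> cmod x < R2} x * ennreal (cmod (polar_sum n m r p x)) \<partial>lborel)"
proof -
  let ?\<Lambda> = "\<Sum>k<n. m k + r k * p k"
  let ?Q = "polar_sum n m r p"
  let ?I = "{ln R1 / (2 * pi)<..<ln R2 / (2 * pi)}"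
  have "ennreal (2 * pi * (ln R2 - ln R1) * cmod ?\<Lambda>) 
      = ennreal (2 * pi * (2 * pi * cmod ?\<Lambda>)) * ennreal (ln R2 / (2 * pi) - ln R1 / (2 * pi))"
  proof -
    have "2 * pi * (ln R2 - ln R1) * cmod ?\<Lambda> = 2 * pi * (2 * pi * cmod ?\<Lambda>) * (ln R2 / (2 * pi) - ln R1 / (2 * pi))"
      by (simp add: field_simps)
    moreover have "ennreal (2 * pi * (2 * pi * cmod ?\<Lambda>)) * ennreal (ln R2 / (2 * pi) - ln R1 / (2 * pi))
        = ennreal (2 * pi * (2 * pi * cmod ?\<Lambda>) * (ln R2 / (2 * pi) - ln R1 / (2 * pi)))"
      by (rule ennreal_mult'[symmetric]) simp
    ultimately show ?thesis by (simp only:)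
  qed
  also have "\<dots> = (\<integral>\<^sup>+s. ennreal (2 * pi * (2 * pi * cmod ?\<Lambda>)) * indicator ?I s \<partial>lborel)"
    using R by (simp add: nn_integral_cmult divide_right_mono)
  also have "\<dots> \<le> (\<integral>\<^sup>+s. \<integral>\<^sup>+t. indicator ?I s * (indicator {0<..<1} t * 
        (ennreal ((2 * pi * exp (2 * pi * s))\<^sup>2) * ennreal (cmod (?Q (0 + exp (2 * of_real pi * Complex s t)))))) \<partial>lborel \<partial>lborel)"
  proof (rule nn_integral_mono)
    fix s :: real
    let ?R = "exp (2 * pi * s)"
    show "ennreal (2 * pi * (2 * pi * cmod ?\<Lambda>)) * indicator ?I s \<le> (\<integral>\<^sup>+t. indicator ?I s * (indicator {0<..<1} t * 
        (ennreal ((2 * pi * exp (2 * pi * s))\<^sup>2) * ennreal (cmod (?Q (0 + exp (2 * of_real pi * Complex s t)))))) \<partial>lborel)"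
    proof (cases "s \<in> ?I")
      case True
      have "ln R1 < 2 * pi * s" using True by (simp add: field_simps)
      then have "R1 < ?R" using R by (metis exp_less_cancel_iff exp_ln)
      then have bd: "ennreal (2 * pi * cmod ?\<Lambda>) \<le> (\<integral>\<^sup>+t. indicator {0<..<1} t * 
          ennreal (2 * pi * ?R\<^sup>2 * cmod (?Q (of_real ?R * exp (2 * of_real pi * \<i> * of_real t)))) \<partial>lborel)"
        using p by (intro polar_sum_circle_bound) force+
      have [measurable]: "(\<lambda>t. ?Q (complex_of_real ?R * exp (2 * of_real pi * \<i> * of_real t))) \<in> borel_measurable borel"
      proof -
        have [measurable]: "(\<lambda>t::real. complex_of_real ?R * exp (2 * of_real pi * \<i> * of_real t)) \<in> borel_measurable borel"
          by (intro borel_measurable_continuous_onI continuous_intros)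
        show ?thesis by measurable
      qed
      have "ennreal (2 * pi * (2 * pi * cmod ?\<Lambda>)) * indicator ?I s = ennreal (2 * pi) * ennreal (2 * pi * cmod ?\<Lambda>)"
      proof -
        have "ennreal (2 * pi * (2 * pi * cmod ?\<Lambda>)) = ennreal (2 * pi) * ennreal (2 * pi * cmod ?\<Lambda>)"
          by (rule ennreal_mult') simp
        then show ?thesis using True by (simp only: indicator_simps mult_1_right)
      qed
      also have "\<dots> \<le> ennreal (2 * pi) * (\<integral>\<^sup>+t. indicator {0<..<1} t * 
          ennreal (2 * pi * ?R\<^sup>2 * cmod (?Q (of_real ?R * exp (2 * of_real pi * \<i> * of_real t)))) \<partial>lborel)"
        by (rule mult_left_mono[OF bd]) simp
      also have "\<dots> = (\<integral>\<^sup>+t. ennreal (2 * pi) * (indicator {0<..<1} t * 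
          ennreal (2 * pi * ?R\<^sup>2 * cmod (?Q (of_real ?R * exp (2 * of_real pi * \<i> * of_real t))))) \<partial>lborel)"
        by (rule nn_integral_cmult[symmetric]) measurable
      also have "\<dots> = (\<integral>\<^sup>+t. indicator ?I s * (indicator {0<..<1} t * 
        (ennreal ((2 * pi * exp (2 * pi * s))\<^sup>2) * ennreal (cmod (?Q (0 + exp (2 * of_real pi * Complex s t)))))) \<partial>lborel)"
      proof (rule nn_integral_cong)
        fix t :: real
        have e: "of_real ?R * exp (2 * of_real pi * \<i> * of_real t) = exp (2 * of_real pi * Complex s t)"
        proof -
          have "complex_of_real ?R = exp (of_real (2 * pi * s))" by (rule exp_of_real[symmetric])
          moreover have "of_real (2 * pi * s) + 2 * of_real pi * \<i> * of_real t = 2 * of_real pi * Complex s t"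
            by (simp add: Complex_eq algebra_simps)
          ultimately show ?thesis by (simp only: exp_add[symmetric])
        qed
        have "ennreal (2 * pi) * ennreal (2 * pi * ?R\<^sup>2 * x) = ennreal ((2 * pi * ?R)\<^sup>2) * ennreal x" if "x \<ge> 0" for x
          using that by (subst (1 2) ennreal_mult'[symmetric]) (auto simp: power2_eq_square algebra_simps)
        then show "ennreal (2 * pi) * (indicator {0<..<1} t * 
          ennreal (2 * pi * ?R\<^sup>2 * cmod (?Q (of_real ?R * exp (2 * of_real pi * \<i> * of_real t)))))
          = indicator ?I s * (indicator {0<..<1} t * 
        (ennreal ((2 * pi * exp (2 * pi * s))\<^sup>2) * ennreal (cmod (?Q (0 + exp (2 * of_real pi * Complex s t))))))"
          unfolding e using True by (auto simp: indicator_def)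
      qed
      finally show ?thesis .
    qed simp
  qed
  also have "\<dots> = (\<integral>\<^sup>+x. indicator {x. R1 < cmod (x - 0) \<and> cmod (x - 0) < R2} x * ennreal (cmod (?Q x)) \<partial>lborel)"
    by (rule nn_integral_annulus[OF R, symmetric]) measurable
  finally show ?thesis by simp
qed

section \<open>The quadratic differential of a repelling cycle\<close>

locale repelling_cycle =
  fixes c z :: complex and n :: nat and r :: "nat \<Rightarrow> complex"
  assumes per: "exact_period n c z"
    and repelling: "cmod (deriv (quad c ^^ n) z) > 1"
    and r_Suc: "\<And>k. r (Suc k) = r k / (2 * (quad c ^^ k) z) - 1 / (2 * ((quad c ^^ k) z)\<^sup>2)"
    and r_n: "r n = r 0"
begin

definition b :: "nat \<Rightarrow> complex" where "b k = (quad c ^^ k) z"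

definition \<rho> :: complex where "\<rho> = deriv (quad c ^^ n) z"

definition S :: complex where "S = (\<Sum>k<n. r k)"

text \<open>\<open>A 0\<close> is the quadratic differential; \<open>A j\<close> is its pushforward under \<open>f\<^sup>j\<close> with weight \<open>1/(f\<^sup>j)'\<close>.\<close>

definition A :: "nat \<Rightarrow> complex \<Rightarrow> complex" where
  "A j = polar_sum n (\<lambda>k. \<Prod>i<j. 2 * b (k + i)) r (\<lambda>k. b (k + j))"

lemma n: "n \<ge> 1" and cycle: "(quad c ^^ n) z = z"
  using per by (auto simp: exact_period_def)

lemma b_Suc: "b (Suc k) = (b k)\<^sup>2 + c"
  unfolding b_def by (rule iterate_Suc)

lemma b_periodic: "b (k + n) = b k"
  by (simp add: b_def funpow_add cycle)

lemma b_n: "b n = b 0"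
  using b_periodic[of 0] by simp

lemma \<rho>_eq: "\<rho> = (\<Prod>k<n. 2 * b k)"
  by (simp add: \<rho>_def deriv_iterate b_def)

lemma b_nonzero: "k < n \<Longrightarrow> b k \<noteq> 0"
proof
  assume "k < n" "b k = 0"
  then have "\<exists>i\<in>{..<n}. 2 * b i = 0" by auto
  then have "\<rho> = 0" unfolding \<rho>_eq by (intro prod_zero) auto
  then show False using repelling by (simp add: \<rho>_def)
qed

lemma b_inj: "inj_on b {..<n}"
proof -
  have "b i \<noteq> b j" if "i < j" "j < n" for i j
  proof
    assume "b i = b j"
    then have "(quad c ^^ (n - j)) (b i) = (quad c ^^ (n - j)) (b j)" by simp
    then have "b (n - j + i) = b (n - j + j)" by (simp only: b_def funpow_add o_apply)
    then have "(quad c ^^ (n - j + i)) z = z" using that b_n by (simp add: b_def)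
    moreover have "1 \<le> n - j + i" "n - j + i < n" using that by auto
    ultimately show False using per by (auto simp: exact_period_def)
  qed
  then show ?thesis by (intro linorder_inj_onI) auto
qed

lemma green_b: "green c (b k) = 0"
  using green_periodic[OF n cycle] by (simp add: b_def green_iterate)

text \<open>Shifting the window trades the factor \<open>2 * b k\<close> for the equal
  \<open>2 * b (k + n)\<close>. Cancelling it needs \<open>b k \<noteq> 0\<close>, which is known
  for indices below \<open>n\<close> and reached by reduction modulo \<open>n\<close>.\<close>

lemma prod_window: "(\<Prod>i<n. 2 * b (k + i)) = \<rho>"
proof (induction k)
  case (Suc k)
  have "(\<Prod>i<n. 2 * b (Suc k + i)) * (2 * b k) = (\<Prod>i<Suc n. 2 * b (k + i))"
    by (subst prod.lessThan_Suc_shift) (simp add: mult.commute)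
  also have "\<dots> = \<rho> * (2 * b k)" using Suc by (simp add: b_periodic)
  finally show ?case
  proof (cases "b k = 0")
    case True
    have "b (k mod n) = b k"
    proof -
      have "b (m * n + j) = b j" for m j
        by (induction m) (simp_all add: b_periodic add.commute add.left_commute, metis add.commute add.left_commute b_periodic)
      then show ?thesis by (metis div_mult_mod_eq)
    qed
    then show ?thesis using True b_nonzero[of "k mod n"] n by simp
  qed simp
qed (simp add: \<rho>_eq)

lemma A_n: "A n = polar_sum n (\<lambda>_. \<rho>) r b"
  unfolding A_def prod_window b_periodic ..

lemma A_0: "A 0 = polar_sum n (\<lambda>_. 1) r b"
  by (simp add: A_def)

lemma borel_measurable_A [measurable]: "A j \<in> borel_measurable borel"
  unfolding A_def by measurable

lemma AE_generic: "AE x in lborel. x \<noteq> c \<and> (\<forall>k. x \<noteq> b k)"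
proof -
  have "countable (insert c (range b))" by simp
  then have "insert c (range b) \<in> null_sets lborel" by (rule countable_imp_null_set_lborel)
  then show ?thesis by (rule AE_I') auto
qed

lemma A_Suc:
  assumes "q \<noteq> 0" "x = q\<^sup>2 + c" "\<And>k. x \<noteq> b k"
  shows "A (Suc j) x = (A j q - A j (- q)) / (2 * q)"
proof -
  have "A (Suc j) = polar_sum n (\<lambda>k. 2 * b (k + j) * (\<Prod>i<j. 2 * b (k + i))) r (\<lambda>k. (b (k + j))\<^sup>2 + c)"
    unfolding A_def by (simp add: b_Suc[symmetric] mult.commute)
  then show ?thesis
    using polar_sum_vector_pushforward[OF assms(1,2), of n "\<lambda>k. b (k + j)" "\<lambda>k. \<Prod>i<j. 2 * b (k + i)" r] assms(3)
    by (simp add: A_def b_Suc[symmetric])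
qed

text \<open>Induction through \<open>A_Suc\<close>, the triangle inequality over the two preimages,
  and \<open>nn_integral_quad\<close>. That lemma divides by the squared derivative and
  \<open>A_Suc\<close> only by the derivative, so one factor survives; it is absorbed into
  \<open>g\<close>, hence the arbitrary \<open>g\<close>.\<close>

lemma nn_integral_A_le:
  assumes [measurable]: "g \<in> borel_measurable borel"
  shows "(\<integral>\<^sup>+x. g x * ennreal (cmod (A j x)) \<partial>lborel)
     \<le> (\<integral>\<^sup>+w. g ((quad c ^^ j) w) * ennreal (cmod (A 0 w) * cmod (deriv (quad c ^^ j) w)) \<partial>lborel)"
  using assms
proof (induction j arbitrary: g)
  case 0
  then show ?case by (simp add: deriv_iterate)
next
  case (Suc j)
  note [measurable] = Suc.prems
  let ?\<phi> = "\<lambda>w. ennreal (cmod (A j w) * (2 * cmod w))"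
  have "(\<integral>\<^sup>+x. g x * ennreal (cmod (A (Suc j) x)) \<partial>lborel)
     \<le> (\<integral>\<^sup>+x. g x * ((?\<phi> (csqrt (x - c)) + ?\<phi> (- csqrt (x - c))) * ennreal (1 / (4 * cmod (x - c)))) \<partial>lborel)"
  proof (rule nn_integral_mono_AE, rule eventually_mono[OF AE_generic])
    fix x assume x: "x \<noteq> c \<and> (\<forall>k. x \<noteq> b k)"
    define q where "q = csqrt (x - c)"
    have q: "q \<noteq> 0" "x = q\<^sup>2 + c" using x by (simp_all add: q_def)
    have "cmod (A (Suc j) x) = cmod (A j q - A j (- q)) / (2 * cmod q)"
      using A_Suc[OF q, of j] x by (simp add: norm_divide norm_mult)
    also have "\<dots> \<le> (cmod (A j q) + cmod (A j (- q))) / (2 * cmod q)"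
      by (intro divide_right_mono norm_triangle_ineq4) simp
    also have "\<dots> = (cmod (A j q) * (2 * cmod q) + cmod (A j (- q)) * (2 * cmod (- q))) * (1 / (4 * cmod (x - c)))"
      using q(1) by (simp add: q(2) norm_power divide_simps) (simp add: power2_eq_square algebra_simps)
    finally have "ennreal (cmod (A (Suc j) x)) \<le> (?\<phi> q + ?\<phi> (- q)) * ennreal (1 / (4 * cmod (x - c)))"
      by (simp add: ennreal_leI ennreal_mult'[symmetric] ennreal_plus[symmetric] del: ennreal_plus)
    then show "g x * ennreal (cmod (A (Suc j) x))
       \<le> g x * ((?\<phi> (csqrt (x - c)) + ?\<phi> (- csqrt (x - c))) * ennreal (1 / (4 * cmod (x - c))))"
      unfolding q_def by (rule mult_left_mono) simp
  qed
  also have "\<dots> = (\<integral>\<^sup>+w. g (quad c w) * ?\<phi> w \<partial>lborel)"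
    by (rule nn_integral_quad) measurable
  also have "\<dots> = (\<integral>\<^sup>+w. (g (quad c w) * ennreal (2 * cmod w)) * ennreal (cmod (A j w)) \<partial>lborel)"
    by (intro nn_integral_cong) (simp add: ennreal_mult' ac_simps)
  also have "\<dots> \<le> (\<integral>\<^sup>+w. (g (quad c ((quad c ^^ j) w)) * ennreal (2 * cmod ((quad c ^^ j) w))) 
      * ennreal (cmod (A 0 w) * cmod (deriv (quad c ^^ j) w)) \<partial>lborel)"
    by (rule Suc.IH) measurable
  also have "\<dots> = (\<integral>\<^sup>+w. g ((quad c ^^ Suc j) w) * ennreal (cmod (A 0 w) * cmod (deriv (quad c ^^ Suc j) w)) \<partial>lborel)"
  proof (rule nn_integral_cong)
    fix w
    have "deriv (quad c ^^ Suc j) w = deriv (quad c ^^ j) w * (2 * (quad c ^^ j) w)"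
      by (simp only: deriv_iterate prod.lessThan_Suc)
    then have "ennreal (cmod (deriv (quad c ^^ Suc j) w)) = ennreal (cmod (deriv (quad c ^^ j) w)) * ennreal (2 * cmod ((quad c ^^ j) w))"
      by (simp only: norm_mult ennreal_mult'[symmetric] norm_ge_zero norm_numeral)
    then show "g (quad c ((quad c ^^ j) w)) * ennreal (2 * cmod ((quad c ^^ j) w)) 
        * ennreal (cmod (A 0 w) * cmod (deriv (quad c ^^ j) w))
      = g ((quad c ^^ Suc j) w) * ennreal (cmod (A 0 w) * cmod (deriv (quad c ^^ Suc j) w))"
      by (simp only: ennreal_mult' norm_ge_zero funpow.simps o_apply ac_simps)
  qed
  finally show ?case .
qed

lemma A_0_pushforward:
  assumes "q \<noteq> 0" "x = q\<^sup>2 + c" "\<And>k. x \<noteq> b k"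
  shows "A 0 x = (A 0 q + A 0 (- q)) / (4 * q\<^sup>2) + S / (x - c)"
  unfolding A_0 S_def
  by (rule polar_sum_quadratic_pushforward) (use b_nonzero b_Suc b_n r_Suc r_n assms in \<open>auto simp: b_def[symmetric]\<close>)

definition shell_area :: "real \<Rightarrow> real" where
  "shell_area t = area (green_shell c t)"

lemma nn_integral_A_outside:
  assumes t: "t > 0" and N[measurable]: "N \<in> sets borel"
    and disj: "N \<inter> {x. t \<le> green c x} = {}"
    and nbhd: "e > 0" "\<And>k. k < n \<Longrightarrow> ball (b k) e \<subseteq> N"
  shows "(\<integral>\<^sup>+x. indicator {x. t \<le> green c x \<and> green c x < 2 * t} x * ennreal (cmod (A 0 x)) \<partial>lborel)
    \<le> (\<integral>\<^sup>+x. indicator (N - quad c -` N) x * ennreal (cmod (A 0 x)) \<partial>lborel) + ennreal (2 * cmod S * shell_area t)"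
proof -
  let ?a = "\<lambda>x. ennreal (cmod (A 0 x))"
  let ?Y = "{x. t \<le> green c x \<and> green c x < 2 * t}"
  let ?U = "green_shell c (2 * t) - N"
  let ?V = "green_shell c t - quad c -` N"
  let ?X = "green_shell c t - N"
  have [measurable]: "quad c -` N \<in> sets borel"
    using measurable_sets[OF borel_measurable_quad N, of c] by simp
  have [measurable]: "?Y \<in> sets borel" by measurable
  have sh: "x \<in> green_shell c t \<longleftrightarrow> quad c x \<in> green_shell c (2 * t)" for x
    by (simp add: green_shell_def green_quad)
  let ?F = "\<lambda>x. indicator ?U x * ((?a (csqrt (x - c)) + ?a (- csqrt (x - c))) * ennreal (1 / (4 * cmod (x - c))))"
  \<comment> \<open>The term \<open>S / (x - c)\<close> is dominated by the push-forward of the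
    constant \<open>2 * cmod S\<close>, so its integral over the outer shell is that constant times
    the area of the inner shell.\<close>
  let ?G = "\<lambda>x. indicator (green_shell c (2 * t)) x * ((ennreal (2 * cmod S) + ennreal (2 * cmod S)) * ennreal (1 / (4 * cmod (x - c))))"
  have 1: "(\<integral>\<^sup>+x. indicator ?U x * ?a x \<partial>lborel)
     \<le> (\<integral>\<^sup>+x. indicator ?U x * ((?a (csqrt (x - c)) + ?a (- csqrt (x - c))) * ennreal (1 / (4 * cmod (x - c))))
        + indicator (green_shell c (2 * t)) x * ((ennreal (2 * cmod S) + ennreal (2 * cmod S)) * ennreal (1 / (4 * cmod (x - c)))) \<partial>lborel)"
  proof (rule nn_integral_mono_AE, rule eventually_mono[OF AE_generic])
    fix x assume x: "x \<noteq> c \<and> (\<forall>k. x \<noteq> b k)"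
    define q where "q = csqrt (x - c)"
    have q: "q \<noteq> 0" "x = q\<^sup>2 + c" using x by (simp_all add: q_def)
    have "cmod (A 0 x) \<le> cmod ((A 0 q + A 0 (- q)) / (4 * q\<^sup>2)) + cmod (S / (x - c))"
      using A_0_pushforward[OF q] x norm_triangle_ineq by metis
    also have "\<dots> \<le> (cmod (A 0 q) + cmod (A 0 (- q))) / (4 * cmod (x - c)) + cmod S / cmod (x - c)"
      using norm_triangle_ineq by (auto simp: q(2) norm_divide norm_mult intro!: divide_right_mono)
    also have "\<dots> = (cmod (A 0 q) + cmod (A 0 (- q))) * (1 / (4 * cmod (x - c))) + (2 * cmod S + 2 * cmod S) * (1 / (4 * cmod (x - c)))"
      by simp
    finally have "?a x \<le> (?a q + ?a (- q)) * ennreal (1 / (4 * cmod (x - c))) 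
        + (ennreal (2 * cmod S) + ennreal (2 * cmod S)) * ennreal (1 / (4 * cmod (x - c)))"
      by (simp add: ennreal_leI ennreal_mult'[symmetric] ennreal_plus[symmetric] del: ennreal_plus)
    then show "indicator ?U x * ?a x \<le> indicator ?U x * ((?a (csqrt (x - c)) + ?a (- csqrt (x - c))) * ennreal (1 / (4 * cmod (x - c))))
        + indicator (green_shell c (2 * t)) x * ((ennreal (2 * cmod S) + ennreal (2 * cmod S)) * ennreal (1 / (4 * cmod (x - c))))"
      by (auto simp: indicator_def q_def)
  qed
  also have "\<dots> = (\<integral>\<^sup>+w. indicator ?U (quad c w) * ?a w \<partial>lborel)
      + (\<integral>\<^sup>+w. indicator (green_shell c (2 * t)) (quad c w) * ennreal (2 * cmod S) \<partial>lborel)"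
  proof -
    have U: "indicator ?U \<in> borel_measurable borel" and X: "indicator (green_shell c (2 * t)) \<in> borel_measurable borel"
      and a: "?a \<in> borel_measurable borel" and C: "(\<lambda>_. ennreal (2 * cmod S)) \<in> borel_measurable borel"
      by measurable
    have "(\<integral>\<^sup>+x. ?F x + ?G x \<partial>lborel) = (\<integral>\<^sup>+x. ?F x \<partial>lborel) + (\<integral>\<^sup>+x. ?G x \<partial>lborel)"
      by (rule nn_integral_add) measurable
    then show ?thesis by (simp only: nn_integral_quad[OF U a] nn_integral_quad[OF X C])
  qed
  also have "(\<integral>\<^sup>+w. indicator ?U (quad c w) * ?a w \<partial>lborel) = (\<integral>\<^sup>+w. indicator ?V w * ?a w \<partial>lborel)"
    by (intro nn_integral_cong) (auto simp: indicator_def sh)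
  also have "(\<integral>\<^sup>+w. indicator (green_shell c (2 * t)) (quad c w) * ennreal (2 * cmod S) \<partial>lborel)
      = (\<integral>\<^sup>+w. indicator (green_shell c t) w * ennreal (2 * cmod S) \<partial>lborel)"
    by (intro nn_integral_cong) (auto simp: indicator_def sh)
  also have "\<dots> = ennreal (2 * cmod S * shell_area t)"
    by (subst nn_integral_multc)
      (auto simp: emeasure_green_shell shell_area_def area_def ennreal_mult'' mult.commute)
  also have "(\<integral>\<^sup>+w. indicator ?V w * ?a w \<partial>lborel)
     \<le> (\<integral>\<^sup>+w. indicator ?X w * ?a w + indicator (N - quad c -` N) w * ?a w \<partial>lborel)"
    by (intro nn_integral_mono) (auto simp: indicator_def)
  also have "\<dots> = (\<integral>\<^sup>+w. indicator ?X w * ?a w \<partial>lborel) + (\<integral>\<^sup>+w. indicator (N - quad c -` N) w * ?a w \<partial>lborel)"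
    by (rule nn_integral_add) measurable
  finally have main: "(\<integral>\<^sup>+x. indicator ?U x * ?a x \<partial>lborel)
     \<le> (\<integral>\<^sup>+w. indicator ?X w * ?a w \<partial>lborel) + (\<integral>\<^sup>+w. indicator (N - quad c -` N) w * ?a w \<partial>lborel)
        + ennreal (2 * cmod S * shell_area t)"
    by (simp add: add_right_mono)
  have U: "(\<integral>\<^sup>+x. indicator ?U x * ?a x \<partial>lborel) = (\<integral>\<^sup>+x. indicator ?X x * ?a x \<partial>lborel) + (\<integral>\<^sup>+x. indicator ?Y x * ?a x \<partial>lborel)"
  proof (subst nn_integral_add[symmetric])
    show "(\<integral>\<^sup>+x. indicator ?U x * ?a x \<partial>lborel) = (\<integral>\<^sup>+x. indicator ?X x * ?a x + indicator ?Y x * ?a x \<partial>lborel)"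
      using t disj by (intro nn_integral_cong) (auto simp: indicator_def green_shell_def)
  qed measurable
  \<comment> \<open>Off \<open>N\<close> every pole is at distance at least \<open>e\<close>, so
    \<open>M\<close> bounds the differential there. The integral over \<open>?X\<close> is therefore
    finite and may be cancelled.\<close>
  define M where "M = (\<Sum>k<n. 1 / e\<^sup>2 + cmod (r k) / e)"
  have "M \<ge> 0" unfolding M_def using nbhd(1) by (intro sum_nonneg) auto
  have AM: "cmod (A 0 x) \<le> M" if "x \<notin> N" for x
  proof -
    have "cmod (A 0 x) \<le> (\<Sum>k<n. cmod (1 / (x - b k)\<^sup>2 + r k / (x - b k)))"
      unfolding A_0 polar_sum_def by (rule norm_sum)
    also have "\<dots> \<le> M" unfolding M_def
    proof (rule sum_mono)
      fix k assume "k \<in> {..<n}"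
      then have "x \<notin> ball (b k) e" using nbhd(2)[of k] that by auto
      then have "e \<le> cmod (x - b k)" by (simp add: dist_norm norm_minus_commute not_less)
      then have "1 / (cmod (x - b k))\<^sup>2 \<le> 1 / e\<^sup>2" "cmod (r k) / cmod (x - b k) \<le> cmod (r k) / e"
        using nbhd(1) by (auto intro!: divide_left_mono power_mono mult_pos_pos zero_less_power)
      moreover have "cmod (1 / (x - b k)\<^sup>2 + r k / (x - b k)) \<le> 1 / (cmod (x - b k))\<^sup>2 + cmod (r k) / cmod (x - b k)"
        using norm_triangle_ineq[of "1 / (x - b k)\<^sup>2" "r k / (x - b k)"] by (simp add: norm_divide norm_power)
      ultimately show "cmod (1 / (x - b k)\<^sup>2 + r k / (x - b k)) \<le> 1 / e\<^sup>2 + cmod (r k) / e" by linarith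
    qed
    finally show ?thesis .
  qed
  have "(\<integral>\<^sup>+x. indicator ?X x * ?a x \<partial>lborel) \<le> (\<integral>\<^sup>+x. indicator (green_shell c t) x * ennreal M \<partial>lborel)"
    using AM by (intro nn_integral_mono) (auto simp: indicator_def ennreal_leI)
  also have "\<dots> = ennreal (area (green_shell c t)) * ennreal M"
    by (subst nn_integral_multc) (auto simp: emeasure_green_shell)
  also have "\<dots> < \<infinity>" by (simp add: ennreal_mult_less_top)
  finally have "(\<integral>\<^sup>+x. indicator ?X x * ?a x \<partial>lborel) \<noteq> \<infinity>" by simp
  then show ?thesis
    using main unfolding U add.assoc by (simp add: ennreal_add_left_cancel_le)
qed

end

section \<open>Neighbourhoods of the cycle and the annulus they leave uncovered\<close>

lemma eventually_mult_less_at_right: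
  assumes "d > (0::real)"
  shows "\<forall>\<^sub>F e in at_right 0. e * K < d"
proof -
  have "((\<lambda>e. e * K) \<longlongrightarrow> 0 * K) (at_right 0)" by (intro tendsto_intros)
  then show ?thesis using assms by (intro order_tendstoD(2)) auto
qed

context repelling_cycle
begin

text \<open>\<open>H\<close> is \<open>(x - b m)^2 * A 0 x\<close> with the singularity removed. It
  is continuous at \<open>b m\<close> with value 1, the other poles being distinct from
  \<open>b m\<close>.\<close>

lemma A_near_pole:
  assumes "m < n" "\<eta> > 0"
  obtains \<delta> where "\<delta> > 0" "\<And>x. x \<noteq> b m \<Longrightarrow> cmod (x - b m) < \<delta> \<Longrightarrow> cmod (A 0 x) \<le> (1 + \<eta>) / (cmod (x - b m))\<^sup>2"
proof -
  define H where "H = (\<lambda>x. 1 + r m * (x - b m) + (x - b m)\<^sup>2 * (\<Sum>k\<in>{..<n} - {m}. 1 / (x - b k)\<^sup>2 + r k / (x - b k)))"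
  have "b m - b k \<noteq> 0" if "k \<in> {..<n} - {m}" for k
    using b_inj that assms(1) by (auto simp: inj_on_def)
  then have "isCont H (b m)" unfolding H_def by (intro continuous_intros) auto
  then obtain \<delta> where \<delta>: "\<delta> > 0" "\<And>x. dist x (b m) < \<delta> \<Longrightarrow> dist (H x) (H (b m)) < \<eta>"
    using assms(2) unfolding continuous_at_eps_delta by metis
  show ?thesis
  proof (rule that[OF \<delta>(1)])
    fix x assume x: "x \<noteq> b m" "cmod (x - b m) < \<delta>"
    have "A 0 x = (1 / (x - b m)\<^sup>2 + r m / (x - b m)) + (\<Sum>k\<in>{..<n} - {m}. 1 / (x - b k)\<^sup>2 + r k / (x - b k))"
      unfolding A_0 polar_sum_def using assms(1) by (intro sum.remove) auto
    then have HA: "H x = (x - b m)\<^sup>2 * A 0 x"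
      using x(1) by (simp add: H_def algebra_simps) (simp add: power2_eq_square field_simps)
    have "cmod (H x - 1) < \<eta>" using \<delta>(2)[of x] x(2) by (simp add: dist_norm H_def)
    then have "cmod (H x) \<le> 1 + \<eta>" using norm_triangle_ineq[of 1 "H x - 1"] by simp
    then have "(cmod (x - b m))\<^sup>2 * cmod (A 0 x) \<le> 1 + \<eta>" by (simp add: HA norm_mult norm_power)
    then show "cmod (A 0 x) \<le> (1 + \<eta>) / (cmod (x - b m))\<^sup>2"
      using x(1) by (simp add: pos_le_divide_eq mult.commute)
  qed
qed

text \<open>The difference of the images factors as \<open>(x - b k) * (x + b k)\<close>, and the
  second factor has modulus at most \<open>2 * cmod (b k) + s\<close>.\<close>

lemma quad_ball:
  assumes "cmod (x - b k) < s" "s \<le> 2 * cmod (b k) * \<eta>"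
  shows "cmod (quad c x - b (Suc k)) < s * (2 * cmod (b k) * (1 + \<eta>))"
proof -
  have s: "s > 0" using assms(1) norm_ge_zero[of "x - b k"] by linarith
  have "quad c x - b (Suc k) = (x - b k) * (x + b k)"
    by (simp add: quad_def b_Suc power2_eq_square algebra_simps)
  then have "cmod (quad c x - b (Suc k)) = cmod (x - b k) * cmod (x + b k)" by (simp add: norm_mult)
  also have "\<dots> \<le> cmod (x - b k) * (2 * cmod (b k) + s)"
  proof (rule mult_left_mono)
    have "cmod (x + b k) \<le> cmod (x - b k) + cmod (2 * b k)"
      using norm_triangle_ineq[of "x - b k" "2 * b k"] by (simp add: add.commute)
    then show "cmod (x + b k) \<le> 2 * cmod (b k) + s" using assms(1) by (simp add: norm_mult)
  qed simp
  also have "\<dots> < s * (2 * cmod (b k) + s)"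
    using assms(1) s by (intro mult_strict_right_mono) (auto simp: add_nonneg_pos)
  also have "\<dots> \<le> s * (2 * cmod (b k) * (1 + \<eta>))"
    using assms(2) s by (intro mult_left_mono) (auto simp: algebra_simps)
  finally show ?thesis .
qed

text \<open>The radii grow along the cycle slightly faster than the derivative, so that the map sends
  each disc but the last into the next one; only a round annulus of modulus about \<open>ln \<bar>\<rho>\<bar>\<close> is
  left uncovered.\<close>

lemma cycle_neighbourhood:
  assumes t: "t > 0" and \<eta>: "\<eta> > 0"
  obtains N e where "N \<in> sets borel" "N \<inter> {x. t \<le> green c x} = {}" "e > 0"
    "\<And>k. k < n \<Longrightarrow> ball (b k) e \<subseteq> N"
    "(\<integral>\<^sup>+x. indicator (N - quad c -` N) x * ennreal (cmod (A 0 x)) \<partial>lborel)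
       \<le> ennreal ((1 + \<eta>) * (2 * pi * (ln (cmod \<rho>) + real (Suc n) * ln (1 + \<eta>))))"
proof -
  \<comment> \<open>Relative radii of the discs: each step multiplies by the modulus of the
    derivative, enlarged by \<open>1 + \<eta>\<close> as \<open>quad_ball\<close> requires.\<close>
  define w where "w = (\<lambda>k. \<Prod>j<k. 2 * cmod (b j) * (1 + \<eta>))"
  have w0: "w 0 = 1" and w_Suc: "w (Suc k) = w k * (2 * cmod (b k) * (1 + \<eta>))" for k
    by (simp_all add: w_def)
  have w_pos: "w k > 0" if "k \<le> n" for k
    unfolding w_def using that b_nonzero \<eta> by (intro prod_pos) auto
  have w_n: "w n = cmod \<rho> * (1 + \<eta>) ^ n"
  proof -
    have "w k = cmod (\<Prod>j<k. 2 * b j) * (1 + \<eta>) ^ k" for k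
      by (induction k) (simp_all add: w0 w_Suc norm_mult)
    then show ?thesis by (simp add: \<rho>_eq)
  qed
  define m where "m = n - 1"
  have m: "m < n" "Suc m = n" using n by (auto simp: m_def)
  have bm: "b m \<noteq> 0" using b_nonzero m by blast
  obtain \<delta> where \<delta>: "\<delta> > 0" "\<And>x. x \<noteq> b m \<Longrightarrow> cmod (x - b m) < \<delta> \<Longrightarrow> cmod (A 0 x) \<le> (1 + \<eta>) / (cmod (x - b m))\<^sup>2"
    using A_near_pole[OF m(1) \<eta>] by blast
  have "\<exists>d>0. \<forall>x. dist x (b k) < d \<longrightarrow> dist (green c x) (green c (b k)) < t" for k
  proof -
    have "isCont (green c) (b k)"
      using continuous_on_green[of UNIV c] by (simp add: continuous_on_eq_continuous_at)
    then show ?thesis using t unfolding continuous_at_eps_delta by blast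
  qed
  then obtain d where d: "\<And>k. d k > 0" "\<And>k x. dist x (b k) < d k \<Longrightarrow> dist (green c x) (green c (b k)) < t"
    by metis
  define \<kappa> where "\<kappa> = 2 * cmod (b m) * (1 + \<eta>)"
  have \<kappa>: "\<kappa> > 0" using bm \<eta> by (simp add: \<kappa>_def)
  have ev: "\<forall>\<^sub>F e in at_right 0. \<forall>k\<in>{..<n}. e * w k < 2 * cmod (b k) * \<eta> \<and> e * w k < d k"
  proof (rule eventually_ball_finite)
    show "\<forall>k\<in>{..<n}. \<forall>\<^sub>F e in at_right 0. e * w k < 2 * cmod (b k) * \<eta> \<and> e * w k < d k"
      by (intro ballI eventually_conj eventually_mult_less_at_right d(1))
        (use b_nonzero \<eta> in simp)
  qed simp
  have pos: "0 < 2 * cmod (b m) * \<eta>" using bm \<eta> by simp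
  \<comment> \<open>The scale \<open>e\<close> must suit \<open>quad_ball\<close> on every disc and
    on the inner disc around \<open>b m\<close>, keep the discs inside \<open>green c x < t\<close>,
    and keep the last disc within the range of \<open>A_near_pole\<close>.\<close>
  have "\<forall>\<^sub>F e in at_right 0. (\<forall>k\<in>{..<n}. e * w k < 2 * cmod (b k) * \<eta> \<and> e * w k < d k)
     \<and> e * (1 / \<kappa>) < 2 * cmod (b m) * \<eta> \<and> e * w m < \<delta> \<and> (0::real) < e"
    by (rule eventually_conj[OF ev eventually_conj[OF eventually_mult_less_at_right[OF pos]
        eventually_conj[OF eventually_mult_less_at_right[OF \<delta>(1)] eventually_at_right_less]]])
  from eventually_happens'[OF trivial_limit_at_right_real this]
  obtain e where e': "(\<forall>k\<in>{..<n}. e * w k < 2 * cmod (b k) * \<eta> \<and> e * w k < d k)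
     \<and> e * (1 / \<kappa>) < 2 * cmod (b m) * \<eta> \<and> e * w m < \<delta> \<and> 0 < e" ..
  then have e: "\<And>k. k < n \<Longrightarrow> e * w k < 2 * cmod (b k) * \<eta>" "\<And>k. k < n \<Longrightarrow> e * w k < d k"
     "e * (1 / \<kappa>) < 2 * cmod (b m) * \<eta>" "e * w m < \<delta>" "0 < e"
    by blast+
  define N where "N = (\<Union>k<n. ball (b k) (e * w k))"
  define e0 where "e0 = Min ((\<lambda>k. e * w k) ` {..<n})"
  have ne: "(\<lambda>k. e * w k) ` {..<n} \<noteq> {}" using n by (auto simp: lessThan_empty_iff)
  have e0: "e0 > 0" using e(5) w_pos ne by (auto simp: e0_def)
  have nbhd: "ball (b k) e0 \<subseteq> N" if "k < n" for k
  proof -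
    have "e0 \<le> e * w k" unfolding e0_def using that by (intro Min_le) auto
    then have "ball (b k) e0 \<subseteq> ball (b k) (e * w k)" by (rule subset_ball)
    then show ?thesis using that by (auto simp: N_def)
  qed
  have disj: "N \<inter> {x. t \<le> green c x} = {}"
  proof (rule ccontr)
    assume "N \<inter> {x. t \<le> green c x} \<noteq> {}"
    then obtain x k where "k < n" "x \<in> ball (b k) (e * w k)" "t \<le> green c x" by (auto simp: N_def)
    moreover from this have "dist x (b k) < d k" using e(2)[of k] by (simp add: dist_commute)
    ultimately show False using d(2)[of x k] green_b[of k] by (simp add: dist_real_def)
  qed
  \<comment> \<open>The disc of radius \<open>e / \<kappa>\<close> around the last point
    \<open>b m\<close> is mapped into the first disc. The further division by
    \<open>1 + \<eta>\<close> gives the strict inequality that \<open>quad_ball\<close> asks for,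
    and accounts for \<open>Suc n\<close> instead of \<open>n\<close> in the ratio.\<close>
  define r1 r2 where "r1 = e / \<kappa> / (1 + \<eta>)" and "r2 = e * w m"
  have "r2 / r1 = w m * \<kappa> * (1 + \<eta>)" using e(5) \<kappa> \<eta> by (simp add: r1_def r2_def)
  also have "w m * \<kappa> = w n" using w_Suc[of m] m by (simp add: \<kappa>_def)
  also have "w n * (1 + \<eta>) = cmod \<rho> * (1 + \<eta>) ^ Suc n" by (simp add: w_n)
  finally have ratio: "r2 / r1 = cmod \<rho> * (1 + \<eta>) ^ Suc n" .
  have r1: "r1 > 0" using e(5) \<kappa> \<eta> by (simp add: r1_def)
  have \<rho>1: "cmod \<rho> > 1" using repelling by (simp add: \<rho>_def)
  have "1 * 1 < cmod \<rho> * (1 + \<eta>) ^ Suc n"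
    using \<rho>1 \<eta> by (intro mult_strict_mono one_less_power) auto
  then have "1 < r2 / r1" unfolding ratio by simp
  then have r12: "r1 < r2" using r1 by (simp add: pos_less_divide_eq)
  have lnr: "ln r2 - ln r1 = ln (cmod \<rho>) + real (Suc n) * ln (1 + \<eta>)"
  proof -
    have "ln r2 - ln r1 = ln (r2 / r1)" using r1 r12 by (simp add: ln_div)
    also have "\<dots> = ln (cmod \<rho>) + ln ((1 + \<eta>) ^ Suc n)"
      unfolding ratio using \<rho>1 \<eta> by (subst ln_mult) auto
    also have "ln ((1 + \<eta>) ^ Suc n) = real (Suc n) * ln (1 + \<eta>)"
      using \<eta> by (simp add: ln_realpow del: power_Suc)
    finally show ?thesis .
  qed
  have left: "r1 < cmod (x - b m) \<and> cmod (x - b m) < r2" if xN: "x \<in> N" "quad c x \<notin> N" for x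
  proof -
    obtain k where "k < n" "x \<in> ball (b k) (e * w k)"
      using xN(1) unfolding N_def by blast
    then have k: "k < n" "cmod (x - b k) < e * w k"
      by (simp_all add: dist_norm norm_minus_commute)
    have "k = m"
    proof (rule ccontr)
      assume "k \<noteq> m"
      then have "Suc k < n" using k(1) m by auto
      moreover have "cmod (quad c x - b (Suc k)) < e * w k * (2 * cmod (b k) * (1 + \<eta>))"
        by (rule quad_ball[OF k(2)]) (use e(1)[OF k(1)] in simp)
      then have "quad c x \<in> ball (b (Suc k)) (e * w (Suc k))"
        by (simp add: dist_norm norm_minus_commute w_Suc mult.assoc)
      ultimately show False using xN(2) by (auto simp: N_def)
    qed
    moreover have "r1 < cmod (x - b m)"
    proof (rule ccontr)
      assume "\<not> r1 < cmod (x - b m)"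
      moreover have "r1 < e / \<kappa>"
      proof -
        have "e / \<kappa> * 1 < e / \<kappa> * (1 + \<eta>)"
          using e(5) \<kappa> \<eta> by (intro mult_strict_left_mono) auto
        then show ?thesis unfolding r1_def using \<eta> by (subst pos_divide_less_eq) auto
      qed
      ultimately have lt: "cmod (x - b m) < e / \<kappa>" by simp
      have "cmod (quad c x - b (Suc m)) < e / \<kappa> * (2 * cmod (b m) * (1 + \<eta>))"
        by (rule quad_ball[OF lt]) (use e(3) in simp)
      also have "\<dots> = e * w 0" using \<kappa> by (simp add: \<kappa>_def[symmetric] w0)
      finally have "quad c x \<in> ball (b 0) (e * w 0)"
        using m b_n by (simp add: dist_norm norm_minus_commute)
      then show False using xN(2) n by (auto simp: N_def)
    qed
    ultimately show ?thesis using k(2) by (simp add: r2_def)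
  qed
  have "(\<integral>\<^sup>+x. indicator (N - quad c -` N) x * ennreal (cmod (A 0 x)) \<partial>lborel)
     \<le> (\<integral>\<^sup>+x. ennreal (1 + \<eta>) * (indicator {x. r1 < cmod (x - b m) \<and> cmod (x - b m) < r2} x * ennreal (1 / (cmod (x - b m))\<^sup>2)) \<partial>lborel)"
  proof (rule nn_integral_mono)
    fix x
    show "indicator (N - quad c -` N) x * ennreal (cmod (A 0 x)) \<le> 
      ennreal (1 + \<eta>) * (indicator {x. r1 < cmod (x - b m) \<and> cmod (x - b m) < r2} x * ennreal (1 / (cmod (x - b m))\<^sup>2))"
    proof (cases "x \<in> N - quad c -` N")
      case True
      then have l: "r1 < cmod (x - b m) \<and> cmod (x - b m) < r2" using left by simp
      then have "cmod (A 0 x) \<le> (1 + \<eta>) / (cmod (x - b m))\<^sup>2"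
        using r1 e(4) by (intro \<delta>(2)) (auto simp: r2_def)
      then have "ennreal (cmod (A 0 x)) \<le> ennreal ((1 + \<eta>) * (1 / (cmod (x - b m))\<^sup>2))" by (intro ennreal_leI) simp
      also have "\<dots> = ennreal (1 + \<eta>) * ennreal (1 / (cmod (x - b m))\<^sup>2)" using \<eta> by (intro ennreal_mult) auto
      finally show ?thesis using True l by simp
    qed simp
  qed
  also have "\<dots> = ennreal (1 + \<eta>) * ennreal (2 * pi * (ln r2 - ln r1))"
    by (subst nn_integral_cmult, measurable) (simp only: nn_integral_annulus_inverse_square[OF r1 r12])
  also have "\<dots> = ennreal ((1 + \<eta>) * (2 * pi * (ln r2 - ln r1)))"
    using \<eta> by (intro ennreal_mult'[symmetric]) simp
  finally have int: "(\<integral>\<^sup>+x. indicator (N - quad c -` N) x * ennreal (cmod (A 0 x)) \<partial>lborel)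
     \<le> ennreal ((1 + \<eta>) * (2 * pi * (ln (cmod \<rho>) + real (Suc n) * ln (1 + \<eta>))))"
    unfolding lnr .
  have "N \<in> sets borel" by (simp add: N_def borel_open)
  from that[OF this disj e0 nbhd int] show ?thesis .
qed

text \<open>The two preceding estimates hold for every \<eta> > 0, and \<eta> tends to 0 from the
  right. The case \<eta> = 1 shows that the integral is finite, so the limit is taken in the
  reals.\<close>

lemma nn_integral_A_shell:
  assumes t: "t > 0"
  shows "(\<integral>\<^sup>+x. indicator {x. t \<le> green c x \<and> green c x < 2 * t} x * ennreal (cmod (A 0 x)) \<partial>lborel)
    \<le> ennreal (2 * pi * ln (cmod \<rho>) + 2 * cmod S * shell_area t)"
    (is "?I \<le> _")
proof -
  define h where "h = (\<lambda>\<eta>. (1 + \<eta>) * (2 * pi * (ln (cmod \<rho>) + real (Suc n) * ln (1 + \<eta>))) + 2 * cmod S * shell_area t)"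
  have sa: "shell_area t \<ge> 0" by (simp add: shell_area_def area_def)
  have \<rho>1: "cmod \<rho> > 1" using repelling by (simp add: \<rho>_def)
  have le: "?I \<le> ennreal (h \<eta>)" if \<eta>: "\<eta> > 0" for \<eta>
  proof -
    obtain N e where N: "N \<in> sets borel" "N \<inter> {x. t \<le> green c x} = {}" "e > 0"
      "\<And>k. k < n \<Longrightarrow> ball (b k) e \<subseteq> N" and int:
      "(\<integral>\<^sup>+x. indicator (N - quad c -` N) x * ennreal (cmod (A 0 x)) \<partial>lborel)
       \<le> ennreal ((1 + \<eta>) * (2 * pi * (ln (cmod \<rho>) + real (Suc n) * ln (1 + \<eta>))))"
      using cycle_neighbourhood[OF t \<eta>] by blast
    have "?I \<le> (\<integral>\<^sup>+x. indicator (N - quad c -` N) x * ennreal (cmod (A 0 x)) \<partial>lborel) + ennreal (2 * cmod S * shell_area t)"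
      by (rule nn_integral_A_outside[OF t N])
    also have "\<dots> \<le> ennreal ((1 + \<eta>) * (2 * pi * (ln (cmod \<rho>) + real (Suc n) * ln (1 + \<eta>)))) + ennreal (2 * cmod S * shell_area t)"
      by (rule add_right_mono[OF int])
    also have "\<dots> = ennreal (h \<eta>)"
      unfolding h_def using \<eta> \<rho>1 sa by (intro ennreal_plus[symmetric] mult_nonneg_nonneg add_nonneg_nonneg) auto
    finally show ?thesis .
  qed
  then have "?I < \<infinity>" using le_less_trans[OF le[of 1]] by simp
  then obtain y where y: "?I = ennreal y" "y \<ge> 0" by (cases ?I rule: ennreal_cases) auto
  have "y \<le> h \<eta>" if "\<eta> > 0" for \<eta>
  proof -
    have "h \<eta> \<ge> 0" unfolding h_def using that \<rho>1 sa by (intro mult_nonneg_nonneg add_nonneg_nonneg) auto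
    then show ?thesis using le[OF that] y by simp
  qed
  then have ev: "\<forall>\<^sub>F \<eta> in at_right 0. y \<le> h \<eta>"
    using eventually_at_right_less[of "0::real"] by (auto elim: eventually_mono)
  have "(h \<longlongrightarrow> (1 + 0) * (2 * pi * (ln (cmod \<rho>) + real (Suc n) * ln (1 + 0))) + 2 * cmod S * shell_area t) (at_right 0)"
    unfolding h_def by (intro tendsto_intros) auto
  then have "y \<le> (1 + 0) * (2 * pi * (ln (cmod \<rho>) + real (Suc n) * ln (1 + 0))) + 2 * cmod S * shell_area t"
    using ev by (intro tendsto_lowerbound) auto
  then show ?thesis unfolding y by (intro ennreal_leI) simp
qed

section \<open>Assembly of the estimates\<close>

text \<open>The moment is read off from \<open>A n\<close> on a round annulus and pulled back to
  \<open>A 0\<close>. The preimage of the annulus under the \<open>n\<close>-th iterate lies in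
  \<open>t \<le> green c x < 2 * t\<close>, where \<open>M\<close> bounds the derivative.\<close>

lemma cycle_moment_bound:
  assumes t: "t > 0" and R: "0 < R1" "R1 < R2"
    and green_R: "\<And>x. R1 < cmod x \<Longrightarrow> cmod x < R2 \<Longrightarrow> t * 2 ^ n \<le> green c x \<and> green c x < 2 * t * 2 ^ n"
    and b_R: "\<And>k. k < n \<Longrightarrow> cmod (b k) \<le> R1"
    and M: "\<And>w. green c ((quad c ^^ n) w) < 2 * t * 2 ^ n \<Longrightarrow> cmod (deriv (quad c ^^ n) w) \<le> M"
  shows "2 * pi * (ln R2 - ln R1) * cmod (\<Sum>k<n. \<rho> + r k * b k)
    \<le> M * (2 * pi * ln (cmod \<rho>) + 2 * cmod S * shell_area t)"
proof -
  let ?Y = "{x. t \<le> green c x \<and> green c x < 2 * t}"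
  let ?R = "{x. R1 < cmod x \<and> cmod x < R2}"
  have \<rho>1: "cmod \<rho> > 1" using repelling by (simp add: \<rho>_def)
  have "cmod \<rho> \<le> M" unfolding \<rho>_def by (rule M) (use t green_b[of 0] in \<open>simp add: cycle b_def\<close>)
  then have M0: "M \<ge> 0" using \<rho>1 by linarith
  have "ennreal (2 * pi * (ln R2 - ln R1) * cmod (\<Sum>k<n. \<rho> + r k * b k))
     \<le> (\<integral>\<^sup>+x. indicator ?R x * ennreal (cmod (A n x)) \<partial>lborel)"
    unfolding A_n by (rule polar_sum_annulus_bound[OF b_R R])
  also have "\<dots> \<le> (\<integral>\<^sup>+w. indicator ?R ((quad c ^^ n) w) * ennreal (cmod (A 0 w) * cmod (deriv (quad c ^^ n) w)) \<partial>lborel)"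
    by (rule nn_integral_A_le) measurable
  also have "\<dots> \<le> (\<integral>\<^sup>+w. ennreal M * (indicator ?Y w * ennreal (cmod (A 0 w))) \<partial>lborel)"
  proof (rule nn_integral_mono)
    fix w
    show "indicator ?R ((quad c ^^ n) w) * ennreal (cmod (A 0 w) * cmod (deriv (quad c ^^ n) w))
       \<le> ennreal M * (indicator ?Y w * ennreal (cmod (A 0 w)))"
    proof (cases "(quad c ^^ n) w \<in> ?R")
      case True
      then have G: "t * 2 ^ n \<le> green c ((quad c ^^ n) w)" "green c ((quad c ^^ n) w) < 2 * t * 2 ^ n"
        using green_R by auto
      then have "w \<in> ?Y" by (auto simp: green_iterate mult.commute)
      moreover have "ennreal (cmod (A 0 w) * cmod (deriv (quad c ^^ n) w)) \<le> ennreal (M * cmod (A 0 w))"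
        using mult_left_mono[OF M[OF G(2)], of "cmod (A 0 w)"] by (intro ennreal_leI) (simp add: mult.commute)
      ultimately show ?thesis using True M0 by (simp add: ennreal_mult')
    qed simp
  qed
  also have "\<dots> = ennreal M * (\<integral>\<^sup>+w. indicator ?Y w * ennreal (cmod (A 0 w)) \<partial>lborel)"
    by (rule nn_integral_cmult) measurable
  also have "\<dots> \<le> ennreal M * ennreal (2 * pi * ln (cmod \<rho>) + 2 * cmod S * shell_area t)"
    by (intro mult_left_mono nn_integral_A_shell t) simp
  also have "\<dots> = ennreal (M * (2 * pi * ln (cmod \<rho>) + 2 * cmod S * shell_area t))"
    using M0 by (intro ennreal_mult'[symmetric])
  finally have le: "ennreal (2 * pi * (ln R2 - ln R1) * cmod (\<Sum>k<n. \<rho> + r k * b k))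
     \<le> ennreal (M * (2 * pi * ln (cmod \<rho>) + 2 * cmod S * shell_area t))" .
  have "shell_area t \<ge> 0" by (simp add: shell_area_def area_def)
  then have "0 \<le> M * (2 * pi * ln (cmod \<rho>) + 2 * cmod S * shell_area t)"
    using M0 \<rho>1 by (intro mult_nonneg_nonneg add_nonneg_nonneg) auto
  then show ?thesis using le by (simp add: ennreal_le_iff)
qed

end

text \<open>Green's function differs from the logarithm of the modulus by at most
  \<open>ln D\<close>, so the annulus from \<open>L * D\<close> to \<open>L^2 / D\<close> has Green
  values between \<open>ln L\<close> and \<open>2 * ln L\<close>. The choice
  \<open>L = D ^ 4\<close> leaves it the logarithmic width \<open>ln L / 2\<close>.\<close>

lemma main_inequality:
  fixes c z :: complex and n :: nat and D :: real
  assumes rep: "repelling_orbit n c z" and D: "1 + cmod c \<le> D" "1 < D"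
  defines "L \<equiv> D ^ 4" and "\<rho> \<equiv> multiplier n c z" and "\<rho>' \<equiv> multiplier_deriv n c z"
  shows "cmod (of_nat n * \<rho> - of_nat n + 2 * c * (\<rho>' / \<rho>))
     \<le> K_const L n c * (ln (cmod \<rho>) + cmod \<rho>' / cmod \<rho> * (1 / pi) * area {w. 0 < green c w \<and> green c w < ln L / 2 ^ n})"
proof -
  have per: "exact_period n c z" and \<rho>1: "cmod \<rho> > 1"
    using rep by (auto simp: repelling_orbit_def \<rho>_def)
  then have n: "n \<ge> 1" and cyc: "(quad c ^^ n) z = z" by (auto simp: exact_period_def)
  have \<rho>_prod: "\<rho> = (\<Prod>k<n. 2 * (quad c ^^ k) z)" by (simp add: \<rho>_def multiplier_def deriv_iterate)
  have "\<rho> \<noteq> 0" "\<rho> \<noteq> 1" using \<rho>1 by auto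
  have nz: "(quad c ^^ k) z \<noteq> 0" if "k < n" for k
    using \<open>\<rho> \<noteq> 0\<close> that by (auto simp: \<rho>_prod)
  obtain r where r: "\<And>k. r (Suc k) = r k / (2 * (quad c ^^ k) z) - 1 / (2 * ((quad c ^^ k) z)\<^sup>2)" "r n = r 0"
    using periodic_residues_exist[of n "\<lambda>k. (quad c ^^ k) z"] nz \<open>\<rho> \<noteq> 1\<close> unfolding \<rho>_prod by blast
  interpret R: repelling_cycle c z n r
    using per \<rho>1 r by unfold_locales (auto simp: \<rho>_def multiplier_def)
  have R\<rho>: "R.\<rho> = \<rho>" by (simp add: R.\<rho>_def \<rho>_def multiplier_def)
  obtain d where d: "\<And>k. d (Suc k) = 2 * (quad c ^^ k) z * d k + 1" "d n = d 0"
    "\<rho>' = \<rho> * (\<Sum>k<n. d k / (quad c ^^ k) z)"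
    using multiplier_deriv_eq[OF cyc] \<open>\<rho> \<noteq> 0\<close> \<open>\<rho> \<noteq> 1\<close> unfolding \<rho>_def \<rho>'_def by blast
  have "R.S = (\<Sum>k<n. d k / (quad c ^^ k) z)"
    unfolding R.S_def by (rule sum_residues_eq) (use nz r d in auto)
  then have S: "R.S = \<rho>' / \<rho>" using d(3) \<open>\<rho> \<noteq> 0\<close> by simp
  have "2 * c * R.S = of_nat n + (\<Sum>k<n. r k * R.b k)"
    unfolding R.S_def
    by (rule sum_residues_moment) (use R.b_nonzero R.b_Suc R.b_n r in \<open>auto simp: R.b_def[symmetric]\<close>)
  \<comment> \<open>The moment identity turns \<open>2 * c * S - n\<close> into the sum of
    \<open>r k * b k\<close>, which leaves the first moment of \<open>R.A n\<close>.\<close>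
  then have lhs: "of_nat n * \<rho> - of_nat n + 2 * c * (\<rho>' / \<rho>) = (\<Sum>k<n. R.\<rho> + r k * R.b k)"
    unfolding S R\<rho> by (simp add: sum.distrib)
  define l where "l = ln L"
  have lnD: "ln D > 0" and l: "l = 4 * ln D" "l > 0"
    using D(2) by (auto simp: l_def L_def ln_realpow)
  have L1: "L > 1" using D(2) by (simp add: L_def)
  define R1 R2 where "R1 = L * D" and "R2 = L\<^sup>2 / D"
  have lnR: "ln R1 = l + ln D" "ln R2 = 2 * l - ln D"
    using D(2) L1 by (auto simp: R1_def R2_def l_def ln_mult ln_div ln_realpow)
  have R1: "R1 > 1" using D(2) L1 unfolding R1_def by (metis less_1_mult)
  have R2: "R2 > 0" using D(2) L1 by (simp add: R2_def)
  have "ln R1 < ln R2" unfolding lnR using l lnD by simp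
  then have R12: "R1 < R2" using R1 R2 by simp
  have cD: "ln (1 + cmod c) \<le> ln D" using D by (subst ln_le_cancel_iff) (auto simp: add_pos_nonneg)
  have green_R: "l \<le> green c x \<and> green c x < 2 * l" if "R1 < cmod x" "cmod x < R2" for x
  proof -
    have "max 1 (cmod x) = cmod x" using that R1 by simp
    then have "\<bar>green c x - ln (cmod x)\<bar> \<le> ln D" using green_approx[of c x] cD by simp
    moreover have "0 < R1" "0 < cmod x" using that R1 by linarith+
    then have "ln R1 < ln (cmod x)" "ln (cmod x) < ln R2" using that R2 by simp_all
    ultimately show ?thesis unfolding lnR by linarith
  qed
  have b_R: "cmod (R.b k) \<le> R1" for k
  proof -
    have "ln (max 1 (cmod (R.b k))) \<le> ln D"
      using green_approx[of c "R.b k"] cD R.green_b[of k] by simp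
    then have "max 1 (cmod (R.b k)) \<le> D" using D by (subst (asm) ln_le_cancel_iff) auto
    moreover have "D \<le> R1" using L1 D(2) by (simp add: R1_def)
    ultimately show ?thesis by simp
  qed
  define t where "t = l / 2 ^ n"
  have t: "t > 0" "t * 2 ^ n = l" "2 * t * 2 ^ n = 2 * l" using l by (auto simp: t_def)
  define M where "M = Sup {cmod (deriv (quad c ^^ n) z) |z. green c ((quad c ^^ n) z) = 2 * l}"
  have "2 * pi * (ln R2 - ln R1) * cmod (\<Sum>k<n. R.\<rho> + r k * R.b k)
    \<le> M * (2 * pi * ln (cmod R.\<rho>) + 2 * cmod R.S * R.shell_area t)"
  proof (rule R.cycle_moment_bound[OF t(1) _ R12])
    show "0 < R1" using R1 by simp
    show "t * 2 ^ n \<le> green c x \<and> green c x < 2 * t * 2 ^ n" if "R1 < cmod x" "cmod x < R2" for x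
      using green_R[OF that] by (simp only: t)
    show "cmod (deriv (quad c ^^ n) w) \<le> M" if "green c ((quad c ^^ n) w) < 2 * t * 2 ^ n" for w
      using that unfolding M_def t(3) by (rule norm_deriv_iterate_le_Sup)
  qed (rule b_R)
  moreover have "ln R2 - ln R1 = l / 2" using lnR l by simp
  moreover have "R.shell_area t = area {w. 0 < green c w \<and> green c w < ln L / 2 ^ n}"
    by (simp add: R.shell_area_def green_shell_def t_def l_def)
  ultimately have "pi * l * cmod (of_nat n * \<rho> - of_nat n + 2 * c * (\<rho>' / \<rho>))
    \<le> M * (2 * pi * ln (cmod \<rho>) + 2 * cmod (\<rho>' / \<rho>) * area {w. 0 < green c w \<and> green c w < ln L / 2 ^ n})"
    unfolding lhs by (simp add: R\<rho> S)
  then have "cmod (of_nat n * \<rho> - of_nat n + 2 * c * (\<rho>' / \<rho>))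
    \<le> M * (2 * pi * ln (cmod \<rho>) + 2 * cmod (\<rho>' / \<rho>) * area {w. 0 < green c w \<and> green c w < ln L / 2 ^ n}) / (pi * l)"
    using l(2) by (simp add: pos_le_divide_eq mult.commute)
  also have "\<dots> = K_const L n c * (ln (cmod \<rho>) + cmod \<rho>' / cmod \<rho> * (1 / pi) * area {w. 0 < green c w \<and> green c w < ln L / 2 ^ n})"
  proof -
    have "M * (2 * pi * x + 2 * y * a) / (pi * l) = 2 / l * M * (x + y * (1 / pi) * a)" for x y a
      using l(2) by (simp add: field_simps)
    moreover have "K_const L n c = 2 / l * M" by (simp only: K_const_def M_def l_def)
    ultimately show ?thesis by (simp only: norm_divide)
  qed
  finally show ?thesis .
qed

text \<open>The periodic point has Green value 0 and serves as the point below the level in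
  \<open>Sup_level_deriv_le\<close>; the factor \<open>L^2\<close> is
  \<open>exp (2 * ln L)\<close>.\<close>

lemma K_const_bound:
  assumes per: "n \<ge> 1" "(quad c ^^ n) z = z" and L: "L > 1"
  shows "K_const L n c \<le> 2 * L\<^sup>2 / ln L * (2 * beta c) ^ n"
proof -
  have "ln L > 0" using L by simp
  moreover have "green c ((quad c ^^ n) z) < 2 * ln L"
    using per green_periodic[OF per] L by simp
  from Sup_level_deriv_le[OF this]
  have "Sup {cmod (deriv (quad c ^^ n) z) |z. green c ((quad c ^^ n) z) = 2 * ln L} \<le> (2 * beta c) ^ n * exp (2 * ln L)" .
  moreover have "exp (2 * ln L) = L\<^sup>2" using L by (simp add: exp_double)
  ultimately have "2 / ln L * Sup {cmod (deriv (quad c ^^ n) z) |z. green c ((quad c ^^ n) z) = 2 * ln L}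
     \<le> 2 / ln L * ((2 * beta c) ^ n * L\<^sup>2)"
    by (intro mult_left_mono) auto
  then show ?thesis by (simp add: K_const_def mult_ac)
qed

theorem theorem3:
  "\<exists>(L::real) (B::real) (B0::real). L > 1 \<and> B > 0 \<and> B0 > 0 \<and>
     (\<forall>(n::nat) (c::complex) (z::complex).
        n \<ge> 1 \<and> repelling_orbit n c z \<and> cmod (multiplier n c z) < exp 1 \<longrightarrow>
        (let \<rho> = multiplier n c z; \<rho>' = multiplier_deriv n c z in
           cmod (of_nat n * \<rho> - of_nat n + 2 * c * (\<rho>' / \<rho>))
             \<le> K_const L n c *
                 (ln (cmod \<rho>) +
                  cmod \<rho>' / cmod \<rho> * (1 / pi) *
                    area {w. 0 < green c w \<and> green c w < ln L / 2 ^ n})) \<and>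
        K_const L n c \<le> B * (2 * beta c) ^ n \<and>
        K_const L n c \<le> B0 * 4 ^ n)"
proof -
  \<comment> \<open>\<open>parameter_bound\<close> gives \<open>cmod c \<le> 2 * (exp 1)^2\<close>,
    so this \<open>D\<close> dominates \<open>1 + cmod c\<close> for all admissible parameters and
    \<open>L\<close> is absolute.\<close>
  define D :: real where "D = 1 + 2 * (exp 1)\<^sup>2"
  define L where "L = D ^ 4"
  define B where "B = 2 * L\<^sup>2 / ln L"
  have D: "D > 1" by (simp add: D_def)
  then have L: "L > 1" by (simp add: L_def)
  then have B: "B > 0" by (simp add: B_def)
  show ?thesis
  proof (intro exI conjI allI impI)
    show "L > 1" "B > 0" "B * (exp 1)\<^sup>2 > 0" using L B by auto
    fix n :: nat and c z :: complex
    assume *: "n \<ge> 1 \<and> repelling_orbit n c z \<and> cmod (multiplier n c z) < exp 1"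
    then have per: "n \<ge> 1" "(quad c ^^ n) z = z" and rep: "repelling_orbit n c z"
      and \<rho>: "cmod (deriv (quad c ^^ n) z) < exp 1"
      by (auto simp: repelling_orbit_def exact_period_def multiplier_def)
    have "1 + cmod c \<le> D" using parameter_bound(2)[OF per \<rho>] by (simp add: D_def)
    from main_inequality[OF rep this D]
    show "let \<rho> = multiplier n c z; \<rho>' = multiplier_deriv n c z in
           cmod (of_nat n * \<rho> - of_nat n + 2 * c * (\<rho>' / \<rho>))
             \<le> K_const L n c *
                 (ln (cmod \<rho>) +
                  cmod \<rho>' / cmod \<rho> * (1 / pi) *
                    area {w. 0 < green c w \<and> green c w < ln L / 2 ^ n})"
      unfolding Let_def L_def .
    show K: "K_const L n c \<le> B * (2 * beta c) ^ n"
      unfolding B_def by (rule K_const_bound[OF per L])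
    \<comment> \<open>\<open>beta c ^ n\<close> exceeds \<open>2 ^ n\<close> by at most the factor
      \<open>(exp 1)^2\<close>, which is why the last constant is
      \<open>B * (exp 1)^2\<close>.\<close>
    have "(2 * beta c) ^ n \<le> (exp 1)\<^sup>2 * 4 ^ n"
    proof -
      have "(2 * beta c) ^ n = 2 ^ n * beta c ^ n" by (rule power_mult_distrib)
      also have "\<dots> \<le> 2 ^ n * ((exp 1)\<^sup>2 * 2 ^ n)"
        by (rule mult_left_mono[OF parameter_bound(1)[OF per \<rho>]]) simp
      also have "\<dots> = (exp 1)\<^sup>2 * (2 * 2) ^ n" by (simp only: power_mult_distrib mult_ac)
      finally show ?thesis by simp
    qed
    then have "B * (2 * beta c) ^ n \<le> B * ((exp 1)\<^sup>2 * 4 ^ n)"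
      using B by (intro mult_left_mono) auto
    with K show "K_const L n c \<le> B * (exp 1)\<^sup>2 * 4 ^ n" by (simp only: mult.assoc) 
  qed
qed

end
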